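(* Let $G_c$ and $G_r$ be graphs on $n$ and $p$ vertices with Laplacians $\mathcal{L}_c\in\mathbb{R}^{n\times n}$ and $\mathcal{L}_r\in\mathbb{R}^{p\times p}$, let $1\le k_c\le n$, $1\le k_r\le p$, and let $Q_{k_c}$, $P_{k_r}$, $\nu_{k_c}$, $\nu_{k_r}$ and $\mathcal{LR}(P_{k_r},Q_{k_c})$ be as in the context. Let $M_r\in\mathbb{R}^{\rho_r\times p}$ and $M_c\in\mathbb{R}^{n\times\rho_c}$ be the random row and column subsampling matrices obtained by drawing $\rho_r$ indices from $\{1,\dots,p\}$ and $\rho_c$ indices from $\{1,\dots,n\}$ uniformly without replacement. For any $\delta,\epsilon\in(0,1)$, if $$\rho_c\ \ge\ \frac{27}{\delta^2}\,\nu_{k_c}^2\,\log\!\left(\frac{4k_c}{\epsilon}\right)\quad\text{and}\quad \rho_r\ \ge\ \frac{27}{\delta^2}\,\nu_{k_r}^2\,\log\!\left(\frac{4k_r}{\epsilon}\right),$$ then with probability at least $1-\epsilon$, $$(1-\delta)\,\|Y\|_F^2\ \le\ \frac{np}{\rho_r\rho_c}\,\|M_rYM_c\|_F^2\ \le\ (1+\delta)\,\|Y\|_F^2$$ holds simultaneously for all $Y\in\mathcal{LR}(P_{k_r},Q_{k_c})$.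
   Context: $G_c$ and $G_r$ are undirected graphs with nonnegative symmetric weighted adjacency matrices $W$ and diagonal degree matrices $D$, $D_{ii}=\sum_jW_{ij}$; the Laplacian is $D-W$ (or its normalized form $D^{-1/2}(D-W)D^{-1/2}$). Write eigendecompositions $\mathcal{L}_c=Q\Lambda_cQ^\top$ and $\mathcal{L}_r=P\Lambda_rP^\top$ with $Q,P$ orthogonal and eigenvalues sorted in increasing order. $Q_{k_c}\in\mathbb{R}^{n\times k_c}$ consists of the first $k_c$ columns of $Q$ and $P_{k_r}\in\mathbb{R}^{p\times k_r}$ of the first $k_r$ columns of $P$. $\mathcal{LR}(P_{k_r},Q_{k_c})$ is the set of matrices $Y\in\mathbb{R}^{p\times n}$ all of whose columns lie in $\mathrm{span}(P_{k_r})$ and all of whose rows (viewed as vectors of $\mathbb{R}^n$) lie in $\mathrm{span}(Q_{k_c})$, where span of a matrix means the span of its columns. Sampling matrices: if $\Omega_c=\{\omega_1,\dots,\omega_{\rho_c}\}\subset\{1,\dots,n\}$ are the drawn column indices, $(M_c)_{ij}=1$ if $i=\omega_j$ and $0$ otherwise; if $\Omega_r=\{\omega_1,\dots,\omega_{\rho_r}\}\subset\{1,\dots,p\}$ are the drawn row indices, $(M_r)_{ij}=1$ if $j=\omega_i$ and $0$ otherwise. Graph cumulative coherence: $\nu_{k_c}=\max_{1\le i\le n}\sqrt{n}\,\|Q_{k_c}^\top\Delta^c_i\|_2$ and $\nu_{k_r}=\max_{1\le j\le p}\sqrt{p}\,\|P_{k_r}^\top\Delta^r_j\|_2$, where $\Delta^c_i\in\{0,1\}^n$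 (resp. $\Delta^r_j\in\{0,1\}^p$) is the vector equal to $1$ at entry $i$ (resp. $j$) and $0$ elsewhere. $\|\cdot\|_F$ is the Frobenius norm. *)

theory Defs
  imports "HOL-Probability.Probability" "Jordan_Normal_Form.VS_Connect"
begin

unbundle no vec_syntax
unbundle no inner_syntax

definition weighted_graph :: "nat \<Rightarrow> real mat \<Rightarrow> bool" where
  "weighted_graph n W \<longleftrightarrow> W \<in> carrier_mat n n \<and> transpose_mat W = W \<and>
     (\<forall>i<n. \<forall>j<n. 0 \<le> W $$ (i, j))"

definition degree_mat :: "nat \<Rightarrow> real mat \<Rightarrow> real mat" where
  "degree_mat n W = mat_diag n (\<lambda>i. \<Sum>j<n. W $$ (i, j))"

definition laplacian :: "nat \<Rightarrow> real mat \<Rightarrow> real mat" where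
  "laplacian n W = degree_mat n W - W"

text \<open>Vertices of degree zero are treated as usual: since \<open>1 / 0 = 0\<close>, the corresponding
  diagonal entry of the inverse square root of the degree matrix is zero.\<close>

definition degree_inv_sqrt_mat :: "nat \<Rightarrow> real mat \<Rightarrow> real mat" where
  "degree_inv_sqrt_mat n W = mat_diag n (\<lambda>i. 1 / sqrt (degree_mat n W $$ (i, i)))"

definition normalized_laplacian :: "nat \<Rightarrow> real mat \<Rightarrow> real mat" where
  "normalized_laplacian n W =
     degree_inv_sqrt_mat n W * (degree_mat n W - W) * degree_inv_sqrt_mat n W"

definition is_graph_laplacian :: "nat \<Rightarrow> real mat \<Rightarrow> real mat \<Rightarrow> bool" where
  "is_graph_laplacian n W L \<longleftrightarrow> L = laplacian n W \<or> L = normalized_laplacian n W"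

text \<open>The library's \<^const>\<open>orthogonal_mat\<close> only asks for orthogonal nonzero columns,
  hence the explicit orthonormality condition.\<close>

definition sorted_eigendecomposition ::
  "nat \<Rightarrow> real mat \<Rightarrow> real mat \<Rightarrow> real mat \<Rightarrow> bool" where
  "sorted_eigendecomposition n L Q \<Lambda> \<longleftrightarrow>
     Q \<in> carrier_mat n n \<and> transpose_mat Q * Q = 1\<^sub>m n \<and>
     \<Lambda> \<in> carrier_mat n n \<and> diagonal_mat \<Lambda> \<and> sorted (diag_mat \<Lambda>) \<and>
     L = Q * \<Lambda> * transpose_mat Q"

definition first_cols :: "nat \<Rightarrow> real mat \<Rightarrow> real mat" where
  "first_cols k Q = mat_of_cols (dim_row Q) (take k (cols Q))"

definition low_rank_on_graphs :: "real mat \<Rightarrow> real mat \<Rightarrow> real mat set" where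
  "low_rank_on_graphs P Q = {Y \<in> carrier_mat (dim_row P) (dim_row Q).
     (\<forall>j<dim_row Q. col Y j \<in> vec_space.col_space (dim_row P) P) \<and>
     (\<forall>i<dim_row P. row Y i \<in> vec_space.col_space (dim_row Q) Q)}"

definition l2_norm_vec :: "real vec \<Rightarrow> real" where
  "l2_norm_vec v = sqrt (v \<bullet> v)"

definition frobenius_norm :: "real mat \<Rightarrow> real" where
  "frobenius_norm A = sqrt (\<Sum>i<dim_row A. \<Sum>j<dim_col A. (A $$ (i, j))\<^sup>2)"

definition cumulative_coherence :: "real mat \<Rightarrow> real" where
  "cumulative_coherence Q = (MAX i\<in>{..<dim_row Q}.
     sqrt (real (dim_row Q)) * l2_norm_vec (transpose_mat Q *\<^sub>v unit_vec (dim_row Q) i))"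

text \<open>Uniform draw of \<open>m\<close> pairwise distinct indices, listed in the order drawn;
  indices start at 0. This requires \<open>m \<le> n\<close>.\<close>

definition draw_without_replacement :: "nat \<Rightarrow> nat \<Rightarrow> nat list pmf" where
  "draw_without_replacement n m =
     pmf_of_set {xs. length xs = m \<and> distinct xs \<and> set xs \<subseteq> {..<n}}"

definition col_sampling_mat :: "nat \<Rightarrow> nat list \<Rightarrow> real mat" where
  "col_sampling_mat n \<omega> = mat n (length \<omega>) (\<lambda>(i, j). if i = \<omega> ! j then 1 else 0)"

definition row_sampling_mat :: "nat \<Rightarrow> nat list \<Rightarrow> real mat" where
  "row_sampling_mat p \<omega> = mat (length \<omega>) p (\<lambda>(i, j). if j = \<omega> ! i then 1 else 0)"

end

theory Submission
  imports Defs
begin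

text \<open>Let \<open>v\<^sub>i\<close> be the rows of \<open>Q\<^sub>k\<close>, so that \<open>\<Sum>\<^sub>i v\<^sub>i v\<^sub>i\<^sup>T = I\<close> and \<open>|v\<^sub>i|\<^sup>2 \<le> \<nu>\<^sup>2 / n\<close>. Sampling a vector of
  the span of \<open>Q\<^sub>k\<close> on an index set \<open>U\<close> is governed by the extreme eigenvalues of
  \<open>S\<^sub>U = \<Sum>\<^sub>i\<^sub>\<in>\<^sub>U v\<^sub>i v\<^sub>i\<^sup>T\<close>. These are controlled by a matrix Chernoff argument in which the trace of
  \<open>exp (\<plusminus> \<theta> S\<^sub>U)\<close> is replaced by \<open>tr ((I \<plusminus> (\<theta> / m) S\<^sub>U)\<^sup>m)\<close> with \<open>m\<close> odd and tending to infinity; no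
  spectral theorem and no Golden-Thompson inequality is needed.

  For positive semidefinite \<open>G\<close>, \<open>A\<close> and odd \<open>m\<close> the sequence \<open>j \<mapsto> tr (G\<^sup>j A\<^sup>m\<^sup>-\<^sup>j)\<close> is convex: its second
  differences are \<open>tr (G\<^sup>p D A\<^sup>q D)\<close> with \<open>D = G - A\<close> and \<open>p + q\<close> odd, so one of the exponents is even.
  This gives the tangent inequality \<open>m tr (G\<^sup>m\<^sup>-\<^sup>1 A) \<le> (m - 1) tr (G\<^sup>m) + tr (A\<^sup>m)\<close>, which bounds the
  effect of adding one rank-one summand and also gives the midpoint convexity through which a
  bound for one uniform draw with replacement becomes a bound for one without. Because the summands have
  rank one, \<open>v\<^sup>T (B + t v v\<^sup>T)\<^sup>i v\<close> is compared with \<open>v\<^sup>T B\<^sup>i v\<close> by an elementary recursion.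

  With failure probability at most \<open>\<epsilon> / 2\<close> for each graph, the row sampling and the column sampling are
  near isometries with constants \<open>1 - \<delta> / 2\<close> and \<open>1 + 0.414 \<delta>\<close>, whose squares are at least \<open>1 - \<delta>\<close> and at
  most \<open>1 + \<delta>\<close>. Applying one to the rows and the other to the columns of \<open>Y\<close> finishes the proof. Only
  a union bound is used, so the two draws may be dependent.\<close>

section \<open>Powers of positive semidefinite matrices\<close>

text \<open>Symmetry is required explicitly: for real matrices it does not follow from nonnegativity
  of the form.\<close>

definition psd_mat :: "nat \<Rightarrow> real mat \<Rightarrow> bool" where
  "psd_mat k A \<longleftrightarrow> A \<in> carrier_mat k k \<and> transpose_mat A = A \<and>
     (\<forall>x\<in>carrier_vec k. 0 \<le> x \<bullet> (A *\<^sub>v x))"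

definition tr_mat :: "real mat \<Rightarrow> real" where
  "tr_mat A = (\<Sum>i<dim_row A. A $$ (i, i))"

lemma psd_mat_carrier [dest]: "psd_mat k A \<Longrightarrow> A \<in> carrier_mat k k"
  and psd_mat_sym: "psd_mat k A \<Longrightarrow> transpose_mat A = A"
  and psd_mat_nonneg: "psd_mat k A \<Longrightarrow> x \<in> carrier_vec k \<Longrightarrow> 0 \<le> x \<bullet> (A *\<^sub>v x)"
  by (auto simp: psd_mat_def)

lemma pow_mat_add:
  assumes A: "(A :: real mat) \<in> carrier_mat k k"
  shows "A ^\<^sub>m (i + j) = A ^\<^sub>m i * A ^\<^sub>m j"
proof (induction j)
  case 0
  then show ?case using A by (simp add: pow_carrier_mat)
next
  case (Suc j)
  then show ?case using A
    by (simp add: assoc_mult_mat[OF pow_carrier_mat[OF A] pow_carrier_mat[OF A] A])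
qed

lemma pow_mat_Suc_left:
  assumes A: "(A :: real mat) \<in> carrier_mat k k"
  shows "A ^\<^sub>m (Suc j) = A * A ^\<^sub>m j"
  using pow_mat_add[OF A, of 1 j] A by simp

lemma transpose_pow_mat:
  assumes A: "(A :: real mat) \<in> carrier_mat k k" and sym: "transpose_mat A = A"
  shows "transpose_mat (A ^\<^sub>m j) = A ^\<^sub>m j"
proof (induction j)
  case 0
  then show ?case by simp
next
  case (Suc j)
  have "transpose_mat (A ^\<^sub>m (Suc j)) = A * A ^\<^sub>m j"
    using Suc sym transpose_mult[OF pow_carrier_mat[OF A] A] by simp
  then show ?case using pow_mat_Suc_left[OF A] by simp
qed

lemma sym_mat_scalar_prod:
  assumes A: "(A :: real mat) \<in> carrier_mat k k" and sym: "transpose_mat A = A"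
    and x: "x \<in> carrier_vec k" and y: "y \<in> carrier_vec k"
  shows "x \<bullet> (A *\<^sub>v y) = (A *\<^sub>v x) \<bullet> y"
  using transpose_vec_mult_scalar[OF A y x] sym by simp

text \<open>For \<open>0 < c\<close> evaluate at the minimiser \<open>- b / c\<close>. A negative
  \<open>c\<close> would make the quadratic negative for large \<open>s\<close>, and
  \<open>c = 0\<close> leaves an affine function, bounded below only if
  \<open>b = 0\<close>.\<close>

lemma quadratic_nonneg_imp_discriminant:
  fixes a b c :: real
  assumes "\<And>s. 0 \<le> a + 2 * s * b + s\<^sup>2 * c"
  shows "b\<^sup>2 \<le> a * c"
proof (cases "c = 0")
  case True
  have "b = 0"
  proof (rule ccontr)
    assume "b \<noteq> 0"
    \<comment> \<open>At this \<open>s\<close> the value is \<open>- 1\<close>.\<close>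
    then show False using assms[of "- (a + 1) / (2 * b)"] True by (simp add: field_simps)
  qed
  then show ?thesis using True by simp
next
  case False
  have "0 \<le> c"
  proof (rule ccontr)
    assume "\<not> 0 \<le> c"
    then have c: "c < 0" by simp
    have a: "0 \<le> a" using assms[of 0] by simp
    \<comment> \<open>Large enough that \<open>s * c\<close> is at most
      \<open>- (2 * \<bar>b\<bar> + 1 + a)\<close>, with \<open>1 \<le> s\<close>; the quadratic is
      then at most \<open>- 1\<close>.\<close>
    define s where "s = (2 * \<bar>b\<bar> + 1 + a) / (- c) + 1"
    have s1: "1 \<le> s" using c a by (simp add: s_def divide_nonneg_neg)
    have "- c * s = 2 * \<bar>b\<bar> + 1 + a - c" using c by (simp add: s_def field_simps)
    then have cs: "s * c \<le> - (2 * \<bar>b\<bar> + 1 + a)" using c by (simp add: mult.commute)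
    have "a + 2 * s * b + s\<^sup>2 * c = a + s * (2 * b + s * c)" by (simp add: power2_eq_square algebra_simps)
    also have "\<dots> \<le> a + s * (- (1 + a))"
      using cs s1 by (intro add_left_mono mult_left_mono) auto
    also have "\<dots> \<le> a + 1 * (- (1 + a))"
      using s1 a by (intro add_left_mono mult_right_mono_neg) auto
    finally show False using assms[of s] by simp
  qed
  with False have c: "0 < c" by simp
  have "0 \<le> a + 2 * (- b / c) * b + (- b / c)\<^sup>2 * c" by (rule assms)
  also have "\<dots> = a - b\<^sup>2 / c" using c by (simp add: power2_eq_square field_simps)
  finally show ?thesis using c by (simp add: field_simps)
qed

text \<open>The form at \<open>x + s y\<close> is a nonnegative quadratic in \<open>s\<close>, so
  its discriminant is not positive.\<close>

lemma psd_mat_cauchy_schwarz: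
  assumes A: "psd_mat k A" and x: "x \<in> carrier_vec k" and y: "y \<in> carrier_vec k"
  shows "(x \<bullet> (A *\<^sub>v y))\<^sup>2 \<le> (x \<bullet> (A *\<^sub>v x)) * (y \<bullet> (A *\<^sub>v y))"
proof (rule quadratic_nonneg_imp_discriminant)
  fix s :: real
  note Ac = psd_mat_carrier[OF A]
  have [simp]: "A *\<^sub>v x \<in> carrier_vec k" "A *\<^sub>v y \<in> carrier_vec k" "s \<cdot>\<^sub>v y \<in> carrier_vec k"
    "s \<cdot>\<^sub>v (A *\<^sub>v y) \<in> carrier_vec k"
    using Ac x y by auto
  have yx: "y \<bullet> (A *\<^sub>v x) = x \<bullet> (A *\<^sub>v y)"
    using sym_mat_scalar_prod[OF Ac psd_mat_sym[OF A] y x] comm_scalar_prod[of "A *\<^sub>v y" k x] x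
    by simp
  have "A *\<^sub>v (x + s \<cdot>\<^sub>v y) = A *\<^sub>v x + s \<cdot>\<^sub>v (A *\<^sub>v y)"
    using Ac x y mult_add_distrib_mat_vec[OF Ac x, of "s \<cdot>\<^sub>v y"] mult_mat_vec[OF Ac y] by simp
  then have "(x + s \<cdot>\<^sub>v y) \<bullet> (A *\<^sub>v (x + s \<cdot>\<^sub>v y)) =
      x \<bullet> (A *\<^sub>v x) + 2 * s * (x \<bullet> (A *\<^sub>v y)) + s\<^sup>2 * (y \<bullet> (A *\<^sub>v y))"
    using x y yx
    by (simp add: add_scalar_prod_distrib[of _ k] scalar_prod_add_distrib[of _ k]
        scalar_prod_smult_distrib[of _ k] smult_scalar_prod_distrib[of _ k]
        power2_eq_square algebra_simps)
  then show "0 \<le> x \<bullet> (A *\<^sub>v x) + 2 * s * (x \<bullet> (A *\<^sub>v y)) + s\<^sup>2 * (y \<bullet> (A *\<^sub>v y))"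
    using psd_mat_nonneg[OF A, of "x + s \<cdot>\<^sub>v y"] x y by simp
qed

lemma pow_mat_form:
  assumes A: "(A :: real mat) \<in> carrier_mat k k" and sym: "transpose_mat A = A"
    and x: "x \<in> carrier_vec k" and y: "y \<in> carrier_vec k"
  shows "(A ^\<^sub>m i *\<^sub>v x) \<bullet> (A ^\<^sub>m j *\<^sub>v y) = x \<bullet> (A ^\<^sub>m (i + j) *\<^sub>v y)"
  using sym_mat_scalar_prod[OF pow_carrier_mat[OF A] transpose_pow_mat[OF A sym] x,
      of "A ^\<^sub>m j *\<^sub>v y" i] A y
  by (simp add: pow_mat_add[OF A] assoc_mult_mat_vec[OF pow_carrier_mat[OF A] pow_carrier_mat[OF A]]
      mult_mat_vec_carrier[OF pow_carrier_mat[OF A]])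

text \<open>Half of the exponent moves to the left factor: for \<open>j = 2 h\<close> the form is
  the squared norm of \<open>A^h x\<close>, for \<open>j = 2 h + 1\<close> it is the form of
  \<open>A\<close> at \<open>A^h x\<close>.\<close>

lemma psd_pow_mat:
  assumes A: "psd_mat k A"
  shows "psd_mat k (A ^\<^sub>m j)"
proof -
  note Ac = psd_mat_carrier[OF A] and As = psd_mat_sym[OF A]
  have "0 \<le> x \<bullet> (A ^\<^sub>m j *\<^sub>v x)" if x: "x \<in> carrier_vec k" for x
  proof (cases "even j")
    case True
    then obtain h where j: "j = h + h" by (metis evenE mult_2)
    show ?thesis unfolding j pow_mat_form[OF Ac As x x, symmetric]
      unfolding scalar_prod_def by (intro sum_nonneg) (rule zero_le_square)
  next
    case False
    then obtain h where j: "j = h + Suc h" by (metis oddE add_Suc_right mult_2 Suc_eq_plus1)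
    have w: "A ^\<^sub>m h *\<^sub>v x \<in> carrier_vec k"
      using x Ac by (auto intro!: mult_mat_vec_carrier[of _ k k] pow_carrier_mat)
    have "A ^\<^sub>m Suc h *\<^sub>v x = A *\<^sub>v (A ^\<^sub>m h *\<^sub>v x)"
      unfolding pow_mat_Suc_left[OF Ac] by (rule assoc_mult_mat_vec[OF Ac pow_carrier_mat[OF Ac] x])
    then show ?thesis using psd_mat_nonneg[OF A w] pow_mat_form[OF Ac As x x, of h "Suc h"]
      unfolding j by simp
  qed
  then show ?thesis using pow_carrier_mat[OF Ac] transpose_pow_mat[OF Ac As]
    by (auto simp: psd_mat_def)
qed

text \<open>Cauchy-Schwarz for the form of \<open>A ^\<^sub>m j\<close>, applied to \<open>x\<close>
  and \<open>A *\<^sub>v x\<close>.\<close>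

lemma psd_pow_log_convex:
  assumes A: "psd_mat k A" and x: "x \<in> carrier_vec k"
  shows "(x \<bullet> (A ^\<^sub>m Suc j *\<^sub>v x))\<^sup>2 \<le> (x \<bullet> (A ^\<^sub>m j *\<^sub>v x)) * (x \<bullet> (A ^\<^sub>m Suc (Suc j) *\<^sub>v x))"
proof -
  note Ac = psd_mat_carrier[OF A] and As = psd_mat_sym[OF A]
  have Ax: "A *\<^sub>v x \<in> carrier_vec k" using Ac x by auto
  have p: "A ^\<^sub>m Suc i *\<^sub>v x = A ^\<^sub>m i *\<^sub>v (A *\<^sub>v x)" for i
    using assoc_mult_mat_vec[OF pow_carrier_mat[OF Ac] Ac x] by simp
  have 1: "x \<bullet> (A ^\<^sub>m Suc j *\<^sub>v x) = x \<bullet> (A ^\<^sub>m j *\<^sub>v (A *\<^sub>v x))" by (simp only: p)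
  have 2: "x \<bullet> (A ^\<^sub>m Suc (Suc j) *\<^sub>v x) = (A *\<^sub>v x) \<bullet> (A ^\<^sub>m j *\<^sub>v (A *\<^sub>v x))"
  proof -
    have "A ^\<^sub>m 1 = A" using Ac by simp
    then show ?thesis using pow_mat_form[OF Ac As x x, of 1 "Suc j"] by (simp only: p plus_1_eq_Suc)
  qed
  show ?thesis unfolding 1 2
    by (rule psd_mat_cauchy_schwarz[OF psd_pow_mat[OF A] x Ax])
qed

text \<open>The ratios \<open>b (Suc j) / b j\<close> are nondecreasing, so the factor from
  \<open>b l\<close> to \<open>b (Suc l)\<close> is at most the one from \<open>b (l + i)\<close> to
  \<open>b (Suc (l + i))\<close>.\<close>

lemma log_convex_mult_le:
  fixes b :: "nat \<Rightarrow> real"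
  assumes pos: "\<And>j. 0 < b j" and lc: "\<And>j. (b (Suc j))\<^sup>2 \<le> b j * b (Suc (Suc j))"
  shows "b l * b i \<le> b 0 * b (l + i)"
proof -
  have step: "b (Suc j) / b j \<le> b (Suc (Suc j)) / b (Suc j)" for j
    using lc[of j] pos[of j] pos[of "Suc j"] by (simp add: field_simps power2_eq_square)
  have ratio: "b (Suc j) / b j \<le> b (Suc (j + d)) / b (j + d)" for j d
    by (induction d) (auto intro: order_trans step)
  show ?thesis
  proof (induction l)
    case (Suc l)
    have "b (Suc l) * b i = (b (Suc l) / b l) * (b l * b i)" using pos[of l] by simp
    also have "\<dots> \<le> (b (Suc (l + i)) / b (l + i)) * (b 0 * b (l + i))"
      using Suc ratio[of l i] less_imp_le[OF pos] by (intro mult_mono[of _ _ "b l * b i"]) auto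
    also have "\<dots> = b 0 * b (Suc l + i)" using pos[of "l + i"] by simp
    finally show ?case .
  qed simp
qed

section \<open>Convexity of traces of powers\<close>

lemma tr_mat_comm:
  assumes "(A :: real mat) \<in> carrier_mat k l" "B \<in> carrier_mat l k"
  shows "tr_mat (A * B) = tr_mat (B * A)"
proof -
  have "tr_mat (A * B) = (\<Sum>i<k. \<Sum>j<l. A $$ (i, j) * B $$ (j, i))"
    using assms by (auto simp: tr_mat_def scalar_prod_def lessThan_atLeast0 intro!: sum.cong)
  also have "\<dots> = (\<Sum>j<l. \<Sum>i<k. A $$ (i, j) * B $$ (j, i))" by (rule sum.swap)
  also have "\<dots> = tr_mat (B * A)"
    using assms by (auto simp: tr_mat_def scalar_prod_def lessThan_atLeast0 mult.commute intro!: sum.cong)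
  finally show ?thesis .
qed

lemma tr_mat_add:
  "A \<in> carrier_mat k k \<Longrightarrow> B \<in> carrier_mat k k \<Longrightarrow> tr_mat (A + B) = tr_mat A + tr_mat B"
  and tr_mat_diff:
  "A \<in> carrier_mat k k \<Longrightarrow> B \<in> carrier_mat k k \<Longrightarrow> tr_mat (A - B) = tr_mat A - tr_mat B"
  by (auto simp: tr_mat_def sum.distrib sum_subtractf)

lemma tr_mat_congruence_nonneg:
  assumes A: "psd_mat k A" and C: "C \<in> carrier_mat k k"
  shows "0 \<le> tr_mat (C * (A * transpose_mat C))"
proof -
  have Ac: "A \<in> carrier_mat k k" using A by auto
  have "(C * (A * transpose_mat C)) $$ (i, i) = row C i \<bullet> (A *\<^sub>v row C i)" if "i < k" for i
  proof -
    have "col (A * transpose_mat C) i = A *\<^sub>v row C i"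
      using that Ac C by (intro eq_vecI) auto
    then show ?thesis using that Ac C by simp
  qed
  then show ?thesis using C Ac
    by (auto simp: tr_mat_def intro!: sum_nonneg psd_mat_nonneg[OF A])
qed

text \<open>One exponent is even and can be halved: if \<open>p = 2 h\<close>, cyclicity turns the
  trace into that of \<open>C A^q C^T\<close> with \<open>C = G^h D\<close>.\<close>

lemma tr_mat_pow_sandwich_nonneg:
  assumes G: "psd_mat k G" and A: "psd_mat k A"
    and D: "D \<in> carrier_mat k k" and Ds: "transpose_mat D = D"
    and odd: "odd (p + q)"
  shows "0 \<le> tr_mat (G ^\<^sub>m p * (D * (A ^\<^sub>m q * D)))"
proof -
  \<comment> \<open>Stated for arbitrary \<open>G\<close> and \<open>A\<close>, because the case of
    even \<open>q\<close> is this one with the two matrices exchanged.\<close>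
  have even_case: "0 \<le> tr_mat (G ^\<^sub>m p * (D * (A ^\<^sub>m q * D)))"
    if G: "psd_mat k G" and A: "psd_mat k A" and even: "even p" for G A p q
  proof -
    obtain h where p: "p = h + h" using even by (metis evenE mult_2)
    note Gc = psd_mat_carrier[OF G] and Ac = psd_mat_carrier[OF A]
    note c = pow_carrier_mat[OF Gc] pow_carrier_mat[OF Ac] D
    note as = assoc_mult_mat[of _ k k _ k _ k]
    have "tr_mat (G ^\<^sub>m p * (D * (A ^\<^sub>m q * D)))
        = tr_mat (G ^\<^sub>m h * (G ^\<^sub>m h * (D * (A ^\<^sub>m q * D))))"
      unfolding p pow_mat_add[OF Gc] using c by (subst as) (auto intro!: mult_carrier_mat[of _ k k])
    also have "\<dots> = tr_mat ((G ^\<^sub>m h * (D * (A ^\<^sub>m q * D))) * G ^\<^sub>m h)"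
      using c by (intro tr_mat_comm[of _ k k]) (auto intro!: mult_carrier_mat[of _ k k])
    also have "(G ^\<^sub>m h * (D * (A ^\<^sub>m q * D))) * G ^\<^sub>m h
        = (G ^\<^sub>m h * D) * (A ^\<^sub>m q * transpose_mat (G ^\<^sub>m h * D))"
      using c Ds transpose_pow_mat[OF Gc psd_mat_sym[OF G]]
      by (simp add: transpose_mult[of _ k k _ k] as mult_carrier_mat[of _ k k])
    also have "0 \<le> tr_mat \<dots>"
      using c by (intro tr_mat_congruence_nonneg[OF psd_pow_mat[OF A]]) (auto intro!: mult_carrier_mat[of _ k k])
    finally show ?thesis .
  qed
  show ?thesis
  proof (cases "even p")
    case True
    then show ?thesis using even_case[OF G A] by blast
  next
    case False
    with odd have q: "even q" by simp
    note c = pow_carrier_mat[OF psd_mat_carrier[OF G]] pow_carrier_mat[OF psd_mat_carrier[OF A]] D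
    note as = assoc_mult_mat[of _ k k _ k _ k]
    have "tr_mat (G ^\<^sub>m p * (D * (A ^\<^sub>m q * D))) = tr_mat ((G ^\<^sub>m p * D) * (A ^\<^sub>m q * D))"
      using c by (subst as) (auto intro!: mult_carrier_mat[of _ k k])
    also have "\<dots> = tr_mat ((A ^\<^sub>m q * D) * (G ^\<^sub>m p * D))"
      using c by (intro tr_mat_comm[of _ k k]) (auto intro!: mult_carrier_mat[of _ k k])
    also have "\<dots> = tr_mat (A ^\<^sub>m q * (D * (G ^\<^sub>m p * D)))"
      using c by (subst as) (auto intro!: mult_carrier_mat[of _ k k])
    finally show ?thesis using even_case[OF A G q] by simp
  qed
qed

text \<open>The right side minus the left is \<open>tr (G^p D A^q D)\<close> with
  \<open>D = G - A\<close>; after expansion, cyclicity moves each trailing \<open>G\<close> to the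
  front.\<close>

lemma tr_mat_pow_convex:
  assumes G: "psd_mat k G" and A: "psd_mat k A" and odd: "odd (p + q)"
  shows "2 * tr_mat (G ^\<^sub>m (p + 1) * A ^\<^sub>m (q + 1))
    \<le> tr_mat (G ^\<^sub>m p * A ^\<^sub>m (q + 2)) + tr_mat (G ^\<^sub>m (p + 2) * A ^\<^sub>m q)"
proof -
  note Gc = psd_mat_carrier[OF G] and Ac = psd_mat_carrier[OF A]
  let ?D = "G - A"
  have Dc: "?D \<in> carrier_mat k k" by (rule minus_carrier_mat[OF Ac])
  have Ds: "transpose_mat ?D = ?D"
    using transpose_minus[OF Gc Ac] psd_mat_sym[OF G] psd_mat_sym[OF A] by simp
  note c = Gc Ac pow_carrier_mat[OF Gc] pow_carrier_mat[OF Ac]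
  have cm: "X * Y \<in> carrier_mat k k" "X - Y \<in> carrier_mat k k"
    if "X \<in> carrier_mat k k" "Y \<in> carrier_mat k k" for X Y :: "real mat"
    using that by (auto intro!: minus_carrier_mat)
  note as = assoc_mult_mat[of _ k k _ k _ k]
  note dl = minus_mult_distrib_mat[of _ k k _ _ k] and dr = mult_minus_distrib_mat[of _ k k _ k]
  have cyc: "tr_mat (G ^\<^sub>m i * (X * G)) = tr_mat (G ^\<^sub>m Suc i * X)" if X: "X \<in> carrier_mat k k" for i X
  proof -
    have "tr_mat (G ^\<^sub>m i * (X * G)) = tr_mat ((G ^\<^sub>m i * X) * G)"
      using c X by (subst as) (auto intro!: mult_carrier_mat[of _ k k])
    also have "\<dots> = tr_mat (G * (G ^\<^sub>m i * X))"
      using c X by (intro tr_mat_comm[of _ k k]) (auto intro!: mult_carrier_mat[of _ k k])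
    also have "\<dots> = tr_mat (G ^\<^sub>m Suc i * X)"
      unfolding pow_mat_Suc_left[OF Gc] using c X by (subst as) (auto intro!: mult_carrier_mat[of _ k k])
    finally show ?thesis .
  qed
  have AA: "A ^\<^sub>m q * (G - A) = A ^\<^sub>m q * G - A ^\<^sub>m Suc q"
    using c by (subst dr) auto
  have "?D * (A ^\<^sub>m q * ?D) = (G * (A ^\<^sub>m q * G) - A * (A ^\<^sub>m q * G))
      - (G * A ^\<^sub>m Suc q - A * A ^\<^sub>m Suc q)"
    unfolding AA using c by (simp add: dl dr cm del: pow_mat.simps)
  also have "\<dots> = (G * (A ^\<^sub>m q * G) - A ^\<^sub>m Suc q * G) - (G * A ^\<^sub>m Suc q - A ^\<^sub>m Suc (Suc q))"
    unfolding pow_mat_Suc_left[OF Ac, of "Suc q"] pow_mat_Suc_left[OF Ac, of q]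
    using c by (simp add: as cm del: pow_mat.simps)
  finally have "G ^\<^sub>m p * (?D * (A ^\<^sub>m q * ?D))
      = (G ^\<^sub>m p * (G * (A ^\<^sub>m q * G)) - G ^\<^sub>m p * (A ^\<^sub>m Suc q * G))
        - (G ^\<^sub>m p * (G * A ^\<^sub>m Suc q) - G ^\<^sub>m p * A ^\<^sub>m Suc (Suc q))"
    using c by (simp add: dr cm del: pow_mat.simps)
  then have "tr_mat (G ^\<^sub>m p * (?D * (A ^\<^sub>m q * ?D)))
      = (tr_mat (G ^\<^sub>m p * (G * (A ^\<^sub>m q * G))) - tr_mat (G ^\<^sub>m p * (A ^\<^sub>m Suc q * G)))
        - (tr_mat (G ^\<^sub>m p * (G * A ^\<^sub>m Suc q)) - tr_mat (G ^\<^sub>m p * A ^\<^sub>m Suc (Suc q)))"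
    using c by (simp add: tr_mat_diff[of _ k] cm del: pow_mat.simps)
  moreover have "G ^\<^sub>m p * (G * (A ^\<^sub>m q * G)) = G ^\<^sub>m Suc p * (A ^\<^sub>m q * G)"
    "G ^\<^sub>m p * (G * A ^\<^sub>m Suc q) = G ^\<^sub>m Suc p * A ^\<^sub>m Suc q"
    using c by (simp_all add: as cm)
  moreover have "tr_mat (G ^\<^sub>m Suc p * (A ^\<^sub>m q * G)) = tr_mat (G ^\<^sub>m Suc (Suc p) * A ^\<^sub>m q)"
    "tr_mat (G ^\<^sub>m p * (A ^\<^sub>m Suc q * G)) = tr_mat (G ^\<^sub>m Suc p * A ^\<^sub>m Suc q)"
    by (rule cyc[OF pow_carrier_mat[OF Ac]])+
  ultimately have "tr_mat (G ^\<^sub>m p * (?D * (A ^\<^sub>m q * ?D))) = tr_mat (G ^\<^sub>m Suc (Suc p) * A ^\<^sub>m q)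
      - 2 * tr_mat (G ^\<^sub>m Suc p * A ^\<^sub>m Suc q) + tr_mat (G ^\<^sub>m p * A ^\<^sub>m Suc (Suc q))"
    by (simp del: pow_mat.simps)
  then show ?thesis
    using tr_mat_pow_sandwich_nonneg[OF G A Dc Ds odd] by (simp del: pow_mat.simps)
qed

text \<open>Convexity makes \<open>a m - a (m - 1)\<close> the largest increment, and
  \<open>a m - a 0\<close> is a sum of \<open>m\<close> increments.\<close>

lemma convex_seq_endpoint:
  fixes a :: "nat \<Rightarrow> real"
  assumes conv: "\<And>j. j + 2 \<le> m \<Longrightarrow> 2 * a (j + 1) \<le> a j + a (j + 2)" and m: "1 \<le> m"
  shows "real m * a (m - 1) \<le> (real m - 1) * a m + a 0"
proof -
  have d: "a (m - d) - a (m - d - 1) \<le> a m - a (m - 1)" if "d < m" for d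
    using that
  proof (induction d)
    case (Suc d)
    then have "m - Suc d - 1 + 2 \<le> m" "m - Suc d - 1 + 1 = m - Suc d" "m - Suc d - 1 + 2 = m - d"
      "m - d - 1 = m - Suc d" by auto
    with conv[of "m - Suc d - 1"] Suc show ?case by simp
  qed simp
  have "a m - a 0 = (\<Sum>i<m. a (Suc i) - a i)" by (simp add: sum_lessThan_telescope)
  also have "\<dots> \<le> (\<Sum>i<m. a m - a (m - 1))"
  proof (rule sum_mono)
    fix i assume "i \<in> {..<m}"
    then show "a (Suc i) - a i \<le> a m - a (m - 1)"
      using d[of "m - Suc i"] by (auto simp: Suc_diff_Suc)
  qed
  finally show ?thesis by (simp add: algebra_simps)
qed

text \<open>Rearranged: \<open>tr (X^m)\<close> lies above its tangent at \<open>G\<close>, whose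
  slope in direction \<open>A - G\<close> is \<open>m tr (G^(m-1) (A - G))\<close>. It is the
  endpoint bound for the sequence \<open>T\<close> from \<open>tr (A^m)\<close> to
  \<open>tr (G^m)\<close>.\<close>

lemma tr_mat_pow_tangent:
  assumes G: "psd_mat k G" and A: "psd_mat k A" and odd: "odd m"
  shows "real m * tr_mat (G ^\<^sub>m (m - 1) * A) \<le> (real m - 1) * tr_mat (G ^\<^sub>m m) + tr_mat (A ^\<^sub>m m)"
proof -
  note Gc = psd_mat_carrier[OF G] and Ac = psd_mat_carrier[OF A]
  define T where "T j = tr_mat (G ^\<^sub>m j * A ^\<^sub>m (m - j))" for j
  have m: "1 \<le> m" using odd by (cases m) auto
  have "real m * T (m - 1) \<le> (real m - 1) * T m + T 0"
  proof (rule convex_seq_endpoint[OF _ m])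
    fix j assume j: "j + 2 \<le> m"
    define q where "q = m - (j + 2)"
    have q: "m - j = q + 2" "m - (j + 1) = q + 1" "m - (j + 2) = q" using j by (auto simp: q_def)
    \<comment> \<open>The two exponents add up to \<open>m - 2\<close>.\<close>
    have "odd (j + q)" using odd j unfolding q_def by (metis add.assoc add_diff_cancel_left' even_add le_add_diff_inverse even_numeral add.commute)
    then show "2 * T (j + 1) \<le> T j + T (j + 2)"
      using tr_mat_pow_convex[OF G A, of j q] unfolding T_def q by simp
  qed
  moreover have "T (m - 1) = tr_mat (G ^\<^sub>m (m - 1) * A)"
    using m Ac unfolding T_def by simp
  moreover have "T m = tr_mat (G ^\<^sub>m m)" "T 0 = tr_mat (A ^\<^sub>m m)"
    unfolding T_def using Gc Ac right_mult_one_mat[OF pow_carrier_mat[OF Gc]]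
      left_mult_one_mat[OF pow_carrier_mat[OF Ac]] by auto
  ultimately show ?thesis by simp
qed

section \<open>Quadratic forms and rank-one updates\<close>

lemma form_pow_0 [simp]:
  "(A :: real mat) \<in> carrier_mat k k \<Longrightarrow> x \<in> carrier_vec k \<Longrightarrow> x \<bullet> (A ^\<^sub>m 0 *\<^sub>v x) = x \<bullet> x"
  by simp

lemma scalar_prod_self_pos:
  assumes "(x :: real vec) \<in> carrier_vec k" "x \<noteq> 0\<^sub>v k"
  shows "0 < x \<bullet> x"
proof -
  obtain i where i: "i < k" "x $ i \<noteq> 0" using assms by (metis carrier_vecD eq_vecI index_zero_vec)
  have "0 < (\<Sum>i<k. x $ i * x $ i)"
    using i by (intro sum_pos2[of _ i]) (auto simp: zero_less_mult_iff less_le not_le)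
  then show ?thesis using assms by (simp add: scalar_prod_def lessThan_atLeast0)
qed

text \<open>By log-convexity two consecutive positive values force the next one to be positive;
  \<open>ge\<close> supplies the value at exponent 1.\<close>

lemma psd_form_pow_pos:
  assumes B: "psd_mat k B" and x: "x \<in> carrier_vec k" and x0: "x \<noteq> 0\<^sub>v k"
    and a: "0 < a" and ge: "a * (x \<bullet> x) \<le> x \<bullet> (B *\<^sub>v x)"
  shows "0 < x \<bullet> (B ^\<^sub>m j *\<^sub>v x)"
proof -
  define b where "b j = x \<bullet> (B ^\<^sub>m j *\<^sub>v x)" for j
  note Bc = psd_mat_carrier[OF B]
  have b0: "0 < b 0" unfolding b_def using scalar_prod_self_pos[OF x x0] Bc x by simp
  have b1: "0 < b (Suc 0)" unfolding b_def
    using mult_pos_pos[OF a scalar_prod_self_pos[OF x x0]] ge Bc by simp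
  have "0 < b j \<and> 0 < b (Suc j)"
  proof (induction j)
    case (Suc j)
    have "0 < (b (Suc j))\<^sup>2" using Suc by simp
    also have "\<dots> \<le> b j * b (Suc (Suc j))"
      unfolding b_def by (rule psd_pow_log_convex[OF B x])
    finally show ?case using Suc by (simp add: zero_less_mult_iff)
  qed (use b0 b1 in simp)
  then show ?thesis by (simp add: b_def)
qed

text \<open>Log-convexity of \<open>j \<mapsto> x \<bullet> B^j x\<close>, which is a positive
  sequence for nonzero \<open>x\<close>.\<close>

lemma psd_form_pow_mult_le:
  assumes B: "psd_mat k B" and x: "x \<in> carrier_vec k"
    and a: "0 < a" and ge: "a * (x \<bullet> x) \<le> x \<bullet> (B *\<^sub>v x)"
  shows "(x \<bullet> (B ^\<^sub>m l *\<^sub>v x)) * (x \<bullet> (B ^\<^sub>m i *\<^sub>v x)) \<le> (x \<bullet> x) * (x \<bullet> (B ^\<^sub>m (l + i) *\<^sub>v x))"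
proof (cases "x = 0\<^sub>v k")
  case True
  have "(0\<^sub>v k :: real vec) \<bullet> (B ^\<^sub>m j *\<^sub>v 0\<^sub>v k) = 0" for j
    using psd_mat_carrier[OF B]
    by (auto intro!: scalar_prod_left_zero mult_mat_vec_carrier[of _ k k] pow_carrier_mat)
  then show ?thesis using True by simp
next
  case False
  show ?thesis
    using log_convex_mult_le[of "\<lambda>j. x \<bullet> (B ^\<^sub>m j *\<^sub>v x)" l i]
      psd_form_pow_pos[OF B x False a ge] psd_pow_log_convex[OF B x]
      form_pow_0[OF psd_mat_carrier[OF B] x]
    by (simp del: pow_mat.simps)
qed

text \<open>The product bound for the exponents 1 and \<open>i\<close>, divided by
  \<open>x \<bullet> x\<close>.\<close>

lemma psd_form_pow_Suc_ge:
  assumes B: "psd_mat k B" and x: "x \<in> carrier_vec k"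
    and a: "0 < a" and ge: "a * (x \<bullet> x) \<le> x \<bullet> (B *\<^sub>v x)"
  shows "a * (x \<bullet> (B ^\<^sub>m i *\<^sub>v x)) \<le> x \<bullet> (B ^\<^sub>m Suc i *\<^sub>v x)"
proof (cases "x = 0\<^sub>v k")
  case True
  have "(0\<^sub>v k :: real vec) \<bullet> (B ^\<^sub>m j *\<^sub>v 0\<^sub>v k) = 0" for j
    using psd_mat_carrier[OF B]
    by (auto intro!: scalar_prod_left_zero mult_mat_vec_carrier[of _ k k] pow_carrier_mat)
  then show ?thesis using True by (simp del: pow_mat.simps)
next
  case False
  have pos: "0 < x \<bullet> x" by (rule scalar_prod_self_pos[OF x False])
  have "a * (x \<bullet> x) * (x \<bullet> (B ^\<^sub>m i *\<^sub>v x)) \<le> (x \<bullet> (B ^\<^sub>m 1 *\<^sub>v x)) * (x \<bullet> (B ^\<^sub>m i *\<^sub>v x))"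
    using ge psd_mat_carrier[OF B] psd_mat_nonneg[OF psd_pow_mat[OF B] x] by (intro mult_right_mono) auto
  also have "\<dots> \<le> (x \<bullet> x) * (x \<bullet> (B ^\<^sub>m Suc i *\<^sub>v x))"
    using psd_form_pow_mult_le[OF B x a ge, of 1 i] by (simp only: plus_1_eq_Suc)
  finally have "(x \<bullet> x) * (a * (x \<bullet> (B ^\<^sub>m i *\<^sub>v x))) \<le> (x \<bullet> x) * (x \<bullet> (B ^\<^sub>m Suc i *\<^sub>v x))"
    by (simp only: mult_ac)
  then show ?thesis using pos by (simp only: mult_le_cancel_left_pos)
qed

text \<open>A case of Jensen's inequality for the \<open>m\<close>-th power, obtained without
  eigenvalues by iterating the one-step bound.\<close>

lemma psd_form_power_le:
  assumes B: "psd_mat k B" and x: "x \<in> carrier_vec k" and unit: "x \<bullet> x = 1"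
    and c: "0 < c" "c \<le> x \<bullet> (B *\<^sub>v x)"
  shows "c ^ m \<le> x \<bullet> (B ^\<^sub>m m *\<^sub>v x)"
proof (induction m)
  case 0
  then show ?case using form_pow_0[OF psd_mat_carrier[OF B] x] unit by simp
next
  case (Suc m)
  have "c ^ Suc m \<le> c * (x \<bullet> (B ^\<^sub>m m *\<^sub>v x))"
    using Suc c by (simp del: pow_mat.simps)
  also have "\<dots> \<le> x \<bullet> (B ^\<^sub>m Suc m *\<^sub>v x)"
    using psd_form_pow_Suc_ge[OF B x, of c] c unit by (simp del: pow_mat.simps)
  finally show ?case .
qed

text \<open>For \<open>i = 2 h\<close> this is the hypothesis at \<open>B^h x\<close>; for odd
  \<open>i\<close> it is the consequence \<open>B^2 \<le> B\<close> of \<open>B \<le> 1\<close> at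
  that vector.\<close>

lemma psd_form_pow_Suc_le:
  assumes B: "psd_mat k B" and x: "x \<in> carrier_vec k"
    and le: "\<And>y. y \<in> carrier_vec k \<Longrightarrow> y \<bullet> (B *\<^sub>v y) \<le> y \<bullet> y"
  shows "x \<bullet> (B ^\<^sub>m Suc i *\<^sub>v x) \<le> x \<bullet> (B ^\<^sub>m i *\<^sub>v x)"
proof -
  note Bc = psd_mat_carrier[OF B] and Bs = psd_mat_sym[OF B]
  have B1: "B ^\<^sub>m 1 = B" using Bc by simp
  \<comment> \<open>Cauchy-Schwarz for \<open>t = |B y|^2\<close>:
    \<open>t^2 = (y \<bullet> B (B y))^2\<close> is at most
    \<open>(y \<bullet> B y) ((B y) \<bullet> B (B y))\<close>, and the last factor is at most
    \<open>t\<close>.\<close>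
  have sq: "(B *\<^sub>v y) \<bullet> (B *\<^sub>v y) \<le> y \<bullet> (B *\<^sub>v y)" if y: "y \<in> carrier_vec k" for y
  proof -
    have By: "B *\<^sub>v y \<in> carrier_vec k" using Bc y by auto
    define t where "t = (B *\<^sub>v y) \<bullet> (B *\<^sub>v y)"
    have t: "t = y \<bullet> (B *\<^sub>v (B *\<^sub>v y))"
      unfolding t_def using sym_mat_scalar_prod[OF Bc Bs y By] by simp
    have "t\<^sup>2 \<le> (y \<bullet> (B *\<^sub>v y)) * ((B *\<^sub>v y) \<bullet> (B *\<^sub>v (B *\<^sub>v y)))"
      unfolding t by (rule psd_mat_cauchy_schwarz[OF B y By])
    also have "\<dots> \<le> (y \<bullet> (B *\<^sub>v y)) * t"
      unfolding t_def by (rule mult_left_mono[OF le[OF By] psd_mat_nonneg[OF B y]])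
    finally have "t * t \<le> (y \<bullet> (B *\<^sub>v y)) * t" by (simp add: power2_eq_square)
    moreover have "0 \<le> t" unfolding t_def scalar_prod_def by (intro sum_nonneg) (rule zero_le_square)
    moreover note psd_mat_nonneg[OF B y]
    ultimately have "t \<le> y \<bullet> (B *\<^sub>v y)" by (cases "t = 0") (auto simp: mult_le_cancel_right)
    then show ?thesis by (simp add: t_def)
  qed
  obtain h where h: "i = h + h \<or> i = h + Suc h"
    by (metis evenE oddE mult_2 add_Suc_right Suc_eq_plus1)
  define w where "w = B ^\<^sub>m h *\<^sub>v x"
  have w: "w \<in> carrier_vec k" unfolding w_def
    using x Bc by (auto intro!: mult_mat_vec_carrier[of _ k k] pow_carrier_mat)
  have Bw: "B ^\<^sub>m Suc h *\<^sub>v x = B *\<^sub>v w" unfolding w_def pow_mat_Suc_left[OF Bc]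
    by (rule assoc_mult_mat_vec[OF Bc pow_carrier_mat[OF Bc] x])
  note pf = pow_mat_form[OF Bc Bs x x]
  from h show ?thesis
  proof
    assume i: "i = h + h"
    have "x \<bullet> (B ^\<^sub>m Suc i *\<^sub>v x) = w \<bullet> (B *\<^sub>v w)"
      using pf[of h "Suc h"] unfolding Bw w_def[symmetric] i by (simp del: pow_mat.simps)
    moreover have "x \<bullet> (B ^\<^sub>m i *\<^sub>v x) = w \<bullet> w"
      using pf[of h h] unfolding w_def[symmetric] i by (simp del: pow_mat.simps)
    ultimately show ?thesis using le[OF w] by simp
  next
    assume i: "i = h + Suc h"
    have "x \<bullet> (B ^\<^sub>m Suc i *\<^sub>v x) = (B *\<^sub>v w) \<bullet> (B *\<^sub>v w)"
      using pf[of "Suc h" "Suc h"] unfolding Bw i by (simp del: pow_mat.simps)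
    moreover have "x \<bullet> (B ^\<^sub>m i *\<^sub>v x) = w \<bullet> (B *\<^sub>v w)"
      using pf[of h "Suc h"] unfolding Bw w_def[symmetric] i by (simp del: pow_mat.simps)
    ultimately show ?thesis using sq[OF w] by simp
  qed
qed

lemma form_eq_entries:
  assumes "(P :: real mat) \<in> carrier_mat k k" "x \<in> carrier_vec k"
  shows "x \<bullet> (P *\<^sub>v y) = (\<Sum>i<k. x $ i * (P *\<^sub>v y) $ i)"
  using assms by (simp add: scalar_prod_def lessThan_atLeast0)

lemma unit_vec_form:
  assumes "(P :: real mat) \<in> carrier_mat k k" "i < k"
  shows "unit_vec k i \<bullet> (P *\<^sub>v unit_vec k i) = P $$ (i, i)"
  using assms by simp

lemma tr_mat_eq_sum_form:
  assumes "(P :: real mat) \<in> carrier_mat k k"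
  shows "tr_mat P = (\<Sum>i<k. unit_vec k i \<bullet> (P *\<^sub>v unit_vec k i))"
  using assms by (simp add: tr_mat_def unit_vec_form)

text \<open>The rows of \<open>1 - x x\<^sup>T\<close> are the vectors \<open>e\<^sub>i - x\<^sub>i x\<close>; summing the form over them gives the
  trace of \<open>P\<close> minus its value at \<open>x\<close>.\<close>

lemma psd_form_le_tr_mat:
  assumes P: "psd_mat k P" and x: "x \<in> carrier_vec k" and unit: "x \<bullet> x = 1"
  shows "x \<bullet> (P *\<^sub>v x) \<le> tr_mat P"
proof -
  note Pc = psd_mat_carrier[OF P]
  let ?e = "unit_vec k :: nat \<Rightarrow> real vec"
  define q where "q = x \<bullet> (P *\<^sub>v x)"
  have Px: "P *\<^sub>v x \<in> carrier_vec k" using Pc x by auto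
  have "0 \<le> P $$ (i, i) - 2 * (x $ i * (P *\<^sub>v x) $ i) + x $ i * x $ i * q" if i: "i < k" for i
  proof -
    define s where "s = - (x $ i)"
    have e: "?e i \<in> carrier_vec k" by simp
    have Pe: "P *\<^sub>v ?e i \<in> carrier_vec k" using Pc by auto
    have sx: "s \<cdot>\<^sub>v x \<in> carrier_vec k" "s \<cdot>\<^sub>v (P *\<^sub>v x) \<in> carrier_vec k" using x Px by auto
    have ex: "?e i \<bullet> (P *\<^sub>v x) = (P *\<^sub>v x) $ i" using Px i by simp
    have xe: "x \<bullet> (P *\<^sub>v ?e i) = (P *\<^sub>v x) $ i"
      using sym_mat_scalar_prod[OF Pc psd_mat_sym[OF P] x e] Px i by simp
    have "P *\<^sub>v (?e i + s \<cdot>\<^sub>v x) = P *\<^sub>v ?e i + s \<cdot>\<^sub>v (P *\<^sub>v x)"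
      using mult_add_distrib_mat_vec[OF Pc e sx(1)] mult_mat_vec[OF Pc x] by simp
    moreover have "(?e i + s \<cdot>\<^sub>v x) \<bullet> (P *\<^sub>v ?e i + s \<cdot>\<^sub>v (P *\<^sub>v x))
        = ?e i \<bullet> (P *\<^sub>v ?e i) + s * (?e i \<bullet> (P *\<^sub>v x)) + s * (x \<bullet> (P *\<^sub>v ?e i)) + s * s * q"
      unfolding q_def using e Pe sx x Px
      by (simp add: add_scalar_prod_distrib[of _ k] scalar_prod_add_distrib[of _ k]
          scalar_prod_smult_distrib[of _ k] smult_scalar_prod_distrib[of _ k] algebra_simps
          del: scalar_prod_left_unit scalar_prod_right_unit)
    ultimately have "0 \<le> ?e i \<bullet> (P *\<^sub>v ?e i) + s * (?e i \<bullet> (P *\<^sub>v x)) + s * (x \<bullet> (P *\<^sub>v ?e i)) + s * s * q"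
      using psd_mat_nonneg[OF P, of "?e i + s \<cdot>\<^sub>v x"] e sx by simp
    then show ?thesis unfolding ex xe unit_vec_form[OF Pc i] s_def by (simp add: algebra_simps)
  qed
  then have "0 \<le> (\<Sum>i<k. P $$ (i, i) - 2 * (x $ i * (P *\<^sub>v x) $ i) + x $ i * x $ i * q)"
    by (intro sum_nonneg) auto
  also have "\<dots> = tr_mat P - 2 * q + (x \<bullet> x) * q"
  proof -
    have "tr_mat P = (\<Sum>i<k. P $$ (i, i))" using Pc by (simp add: tr_mat_def)
    moreover have "(\<Sum>i<k. 2 * (x $ i * (P *\<^sub>v x) $ i)) = 2 * q"
      unfolding q_def form_eq_entries[OF Pc x] sum_distrib_left ..
    moreover have "(\<Sum>i<k. x $ i * x $ i * q) = (x \<bullet> x) * q"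
      using x by (simp add: scalar_prod_def lessThan_atLeast0 sum_distrib_right)
    ultimately show ?thesis by (simp add: sum.distrib sum_subtractf)
  qed
  finally show ?thesis using unit by (simp add: q_def)
qed

definition rank1_mat :: "nat \<Rightarrow> real vec \<Rightarrow> real mat" where
  "rank1_mat k v = mat k k (\<lambda>(i, j). v $ i * v $ j)"

lemma rank1_mat_carrier [simp]: "rank1_mat k v \<in> carrier_mat k k"
  by (simp add: rank1_mat_def)

lemma rank1_mat_mult_vec:
  assumes "v \<in> carrier_vec k" "y \<in> carrier_vec k"
  shows "rank1_mat k v *\<^sub>v y = (v \<bullet> y) \<cdot>\<^sub>v v"
  using assms
  by (intro eq_vecI) (auto simp: rank1_mat_def scalar_prod_def sum_distrib_left mult_ac intro!: sum.cong)

lemma tr_mat_mult_rank1: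
  assumes M: "M \<in> carrier_mat k k" and v: "v \<in> carrier_vec k"
  shows "tr_mat (M * rank1_mat k v) = v \<bullet> (M *\<^sub>v v)"
proof -
  have "(M * rank1_mat k v) $$ (i, i) = v $ i * (M *\<^sub>v v) $ i" if "i < k" for i
    using that M v
    by (auto simp: rank1_mat_def scalar_prod_def sum_distrib_left mult_ac intro!: sum.cong)
  then show ?thesis using M v by (simp add: tr_mat_def form_eq_entries)
qed

text \<open>This is \<open>A^i - B^i = sum B^l (A - B) A^(i-1-l)\<close>: as
  \<open>A - B = t v v^T\<close> has rank one, every summand splits into a product of two scalars.
  \<open>y\<close> is arbitrary because the induction replaces it by \<open>B y\<close>.\<close>

lemma rank1_update_form:
  fixes t :: real
  assumes B: "B \<in> carrier_mat k k" and Bs: "transpose_mat B = B"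
    and v: "v \<in> carrier_vec k" and y: "y \<in> carrier_vec k"
  defines "A \<equiv> B + t \<cdot>\<^sub>m rank1_mat k v"
  shows "y \<bullet> (A ^\<^sub>m i *\<^sub>v v) = y \<bullet> (B ^\<^sub>m i *\<^sub>v v)
    + t * (\<Sum>l<i. (y \<bullet> (B ^\<^sub>m l *\<^sub>v v)) * (v \<bullet> (A ^\<^sub>m (i - 1 - l) *\<^sub>v v)))"
  using y
proof (induction i arbitrary: y)
  case 0
  have "A \<in> carrier_mat k k" using B by (simp add: A_def)
  then show ?case using B v by simp
next
  case (Suc i)
  have Ac: "A \<in> carrier_mat k k" using B by (simp add: A_def)
  define u where "u = A ^\<^sub>m i *\<^sub>v v"
  have u: "u \<in> carrier_vec k" unfolding u_def
    using v Ac by (auto intro!: mult_mat_vec_carrier[of _ k k] pow_carrier_mat)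
  note y = Suc.prems
  have By: "B *\<^sub>v y \<in> carrier_vec k" using B y by auto
  have Bu: "B *\<^sub>v u \<in> carrier_vec k" using B u by auto
  have BS: "y \<bullet> (B ^\<^sub>m Suc l *\<^sub>v v) = (B *\<^sub>v y) \<bullet> (B ^\<^sub>m l *\<^sub>v v)" for l
  proof -
    have "B ^\<^sub>m Suc l *\<^sub>v v = B *\<^sub>v (B ^\<^sub>m l *\<^sub>v v)" unfolding pow_mat_Suc_left[OF B]
      by (rule assoc_mult_mat_vec[OF B pow_carrier_mat[OF B] v])
    then show ?thesis
      using sym_mat_scalar_prod[OF B Bs y mult_mat_vec_carrier[OF pow_carrier_mat[OF B] v]] by simp
  qed
  have "A *\<^sub>v u = B *\<^sub>v u + (t * (v \<bullet> u)) \<cdot>\<^sub>v v"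
  proof -
    have "A *\<^sub>v u = B *\<^sub>v u + (t \<cdot>\<^sub>m rank1_mat k v) *\<^sub>v u"
      unfolding A_def by (rule add_mult_distrib_mat_vec[OF B _ u]) simp
    also have "(t \<cdot>\<^sub>m rank1_mat k v) *\<^sub>v u = t \<cdot>\<^sub>v (rank1_mat k v *\<^sub>v u)"
      using u by (intro eq_vecI) (auto simp: rank1_mat_def)
    finally show ?thesis using rank1_mat_mult_vec[OF v u] by (simp add: smult_smult_assoc)
  qed
  moreover have "A ^\<^sub>m Suc i *\<^sub>v v = A *\<^sub>v u" unfolding u_def pow_mat_Suc_left[OF Ac]
    by (rule assoc_mult_mat_vec[OF Ac pow_carrier_mat[OF Ac] v])
  ultimately have "y \<bullet> (A ^\<^sub>m Suc i *\<^sub>v v) = y \<bullet> (B *\<^sub>v u) + t * (v \<bullet> u) * (y \<bullet> v)"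
    using y v Bu by (simp add: scalar_prod_add_distrib[of _ k] scalar_prod_smult_distrib[of _ k])
  also have "y \<bullet> (B *\<^sub>v u) = (B *\<^sub>v y) \<bullet> u" by (rule sym_mat_scalar_prod[OF B Bs y u])
  also have "\<dots> = y \<bullet> (B ^\<^sub>m Suc i *\<^sub>v v)
      + t * (\<Sum>l<i. (y \<bullet> (B ^\<^sub>m Suc l *\<^sub>v v)) * (v \<bullet> (A ^\<^sub>m (i - 1 - l) *\<^sub>v v)))"
    unfolding u_def BS by (rule Suc.IH[OF By])
  finally show ?case
    unfolding sum.lessThan_Suc_shift u_def using B v y
    by (simp add: algebra_simps del: pow_mat.simps(2))
qed

lemma sum_powers_lessThan:
  "(c :: real) * (\<Sum>l<i. (1 + c) ^ (i - 1 - l)) = (1 + c) ^ i - 1"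
proof -
  have "(\<Sum>l<i. (1 + c) ^ (i - 1 - l)) = (\<Sum>l<i. (1 + c) ^ l)"
    using sum.nat_diff_reindex[of "\<lambda>l. (1 + c) ^ l" i] by simp
  then show ?thesis using power_diff_1_eq[of "1 + c" i] by simp
qed

text \<open>Strong induction through the recursion of \<open>rank1_update_form\<close>:
  log-convexity absorbs the products \<open>\<beta> l * \<beta> (i - 1 - l)\<close>, and the powers
  of \<open>1 + c\<close> that remain form a geometric series.\<close>

lemma rank1_update_form_le:
  assumes B: "psd_mat k B" and v: "v \<in> carrier_vec k" and t: "0 \<le> t"
    and a: "0 < a" and ge: "a * (v \<bullet> v) \<le> v \<bullet> (B *\<^sub>v v)"
  defines "A \<equiv> B + t \<cdot>\<^sub>m rank1_mat k v"
  shows "v \<bullet> (A ^\<^sub>m i *\<^sub>v v) \<le> (1 + t * (v \<bullet> v) / a) ^ i * (v \<bullet> (B ^\<^sub>m i *\<^sub>v v))"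
proof (induction i rule: less_induct)
  case (less i)
  define \<alpha> \<beta> where "\<alpha> i = v \<bullet> (A ^\<^sub>m i *\<^sub>v v)" and "\<beta> i = v \<bullet> (B ^\<^sub>m i *\<^sub>v v)" for i
  define r where "r = v \<bullet> v"
  define c where "c = t * r / a"
  have r: "0 \<le> r" unfolding r_def scalar_prod_def by (intro sum_nonneg) (rule zero_le_square)
  have c: "0 \<le> c" using r t a by (simp add: c_def)
  have \<beta>: "0 \<le> \<beta> j" for j unfolding \<beta>_def by (rule psd_mat_nonneg[OF psd_pow_mat[OF B] v])
  have IH: "\<alpha> j \<le> (1 + c) ^ j * \<beta> j" if "j < i" for j
    using less[OF that] by (simp add: \<alpha>_def \<beta>_def c_def r_def)
  have "\<alpha> i = \<beta> i + t * (\<Sum>l<i. \<beta> l * \<alpha> (i - 1 - l))"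
    unfolding \<alpha>_def \<beta>_def A_def by (rule rank1_update_form[OF psd_mat_carrier[OF B] psd_mat_sym[OF B] v v])
  also have "\<dots> \<le> \<beta> i + t * (\<Sum>l<i. (1 + c) ^ (i - 1 - l) * (r * \<beta> (i - 1)))"
  proof (intro add_left_mono mult_left_mono[OF _ t] sum_mono)
    fix l assume l: "l \<in> {..<i}"
    have "\<beta> l * \<alpha> (i - 1 - l) \<le> \<beta> l * ((1 + c) ^ (i - 1 - l) * \<beta> (i - 1 - l))"
      using l \<beta> by (intro mult_left_mono IH) auto
    also have "\<dots> = (1 + c) ^ (i - 1 - l) * (\<beta> l * \<beta> (i - 1 - l))" by simp
    also have "\<dots> \<le> (1 + c) ^ (i - 1 - l) * (r * \<beta> (i - 1))"
    proof (rule mult_left_mono)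
      have "l + (i - 1 - l) = i - 1" using l by auto
      then show "\<beta> l * \<beta> (i - 1 - l) \<le> r * \<beta> (i - 1)"
        using psd_form_pow_mult_le[OF B v a ge, of l "i - 1 - l"] by (simp add: \<beta>_def r_def)
    qed (use c in simp)
    finally show "\<beta> l * \<alpha> (i - 1 - l) \<le> (1 + c) ^ (i - 1 - l) * (r * \<beta> (i - 1))" .
  qed
  also have "\<dots> \<le> (1 + c) ^ i * \<beta> i"
  proof (cases "i = 0")
    case False
    have ab: "a * \<beta> (i - 1) \<le> \<beta> i"
      using psd_form_pow_Suc_ge[OF B v a ge, of "i - 1"] False by (simp add: \<beta>_def)
    \<comment> \<open>Since \<open>t * r = c * a\<close>, the geometric sum acquires the factor
      \<open>c\<close> and collapses to \<open>(1 + c) ^ i - 1\<close>.\<close>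
    have "t * (\<Sum>l<i. (1 + c) ^ (i - 1 - l) * (r * \<beta> (i - 1)))
        = c * (\<Sum>l<i. (1 + c) ^ (i - 1 - l)) * (a * \<beta> (i - 1))"
      using a by (simp add: sum_distrib_right[symmetric] c_def)
    also have "\<dots> = ((1 + c) ^ i - 1) * (a * \<beta> (i - 1))" by (simp only: sum_powers_lessThan)
    also have "\<dots> \<le> ((1 + c) ^ i - 1) * \<beta> i"
      using ab c by (intro mult_left_mono) (auto simp: one_le_power)
    finally show ?thesis by (simp add: algebra_simps)
  qed simp
  finally show ?case by (simp add: \<alpha>_def \<beta>_def c_def r_def)
qed

section \<open>Averages over subsets of fixed size\<close>

definition subsets_of_card :: "'i set \<Rightarrow> nat \<Rightarrow> 'i set set" where
  "subsets_of_card N s = {U. U \<subseteq> N \<and> card U = s}"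

lemma finite_subsets_of_card [simp]: "finite N \<Longrightarrow> finite (subsets_of_card N s)"
  by (simp add: subsets_of_card_def)

lemma card_subsets_of_card: "finite N \<Longrightarrow> card (subsets_of_card N s) = card N choose s"
  by (simp add: subsets_of_card_def n_subsets)

text \<open>Double counting: a pair \<open>(U, w)\<close> with \<open>w\<close> outside
  \<open>U\<close> corresponds to the pair \<open>(insert w U, w)\<close>.\<close>

lemma sum_subsets_of_card_remove:
  assumes N: "finite N"
  shows "(\<Sum>U\<in>subsets_of_card N s. \<Sum>w\<in>N - U. F U w)
    = (\<Sum>U\<in>subsets_of_card N (Suc s). \<Sum>w\<in>U. F (U - {w}) w)"
proof -
  have fin: "finite U" if "U \<in> subsets_of_card N r" for U r
    using that N finite_subset by (auto simp: subsets_of_card_def)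
  have "(\<Sum>U\<in>subsets_of_card N s. \<Sum>w\<in>N - U. F U w)
      = (\<Sum>(U, w)\<in>(SIGMA U:subsets_of_card N s. N - U). F U w)"
    using N by (intro sum.Sigma) auto
  also have "\<dots> = (\<Sum>(U, w)\<in>(SIGMA U:subsets_of_card N (Suc s). U). F (U - {w}) w)"
  proof (rule sum.reindex_bij_witness[where i = "\<lambda>(U, w). (U - {w}, w)" and j = "\<lambda>(U, w). (insert w U, w)"])
    fix x assume "x \<in> (SIGMA U:subsets_of_card N s. N - U)"
    then obtain U w where "x = (U, w)" "U \<in> subsets_of_card N s" "w \<in> N - U" by auto
    then show "(case case x of (U, w) \<Rightarrow> (insert w U, w) of (U, w) \<Rightarrow> (U - {w}, w)) = x"
      "(case x of (U, w) \<Rightarrow> (insert w U, w)) \<in> (SIGMA U:subsets_of_card N (Suc s). U)"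
      "(case case x of (U, w) \<Rightarrow> (insert w U, w) of (U, w) \<Rightarrow> F (U - {w}) w) = (case x of (U, w) \<Rightarrow> F U w)"
      using fin[of U s] by (auto simp: subsets_of_card_def)
  next
    fix x assume "x \<in> (SIGMA U:subsets_of_card N (Suc s). U)"
    then obtain U w where "x = (U, w)" "U \<in> subsets_of_card N (Suc s)" "w \<in> U" by auto
    then show "(case case x of (U, w) \<Rightarrow> (U - {w}, w) of (U, w) \<Rightarrow> (insert w U, w)) = x"
      "(case x of (U, w) \<Rightarrow> (U - {w}, w)) \<in> (SIGMA U:subsets_of_card N s. N - U)"
      using fin[of U "Suc s"] by (auto simp: subsets_of_card_def)
  qed
  also have "\<dots> = (\<Sum>U\<in>subsets_of_card N (Suc s). \<Sum>w\<in>U. F (U - {w}) w)"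
    using N fin by (intro sum.Sigma[symmetric]) auto
  finally show ?thesis .
qed

lemma sum_ordered_pairs_swap:
  assumes U: "finite U"
  shows "(\<Sum>w\<in>U. \<Sum>v\<in>U - {w}. F w v) = (\<Sum>w\<in>U. \<Sum>v\<in>U - {w}. F v w)"
proof -
  have off: "(\<Sum>v\<in>U - {w}. H v) = (\<Sum>v\<in>U. if v = w then 0 else H v)" for w and H :: "_ \<Rightarrow> 'b"
    using U by (intro sum.mono_neutral_cong_left) auto
  show ?thesis unfolding off by (subst sum.swap) (auto intro!: sum.cong)
qed

definition subset_average :: "'i set \<Rightarrow> nat \<Rightarrow> ('i set \<Rightarrow> real) \<Rightarrow> real" where
  "subset_average N s f = (\<Sum>U\<in>subsets_of_card N s. f U) / real (card N choose s)"

text \<open>Here \<open>h U v\<close> is the value of \<open>f\<close> after adding \<open>v\<close> to the multiset \<open>U\<close>, so that \<open>step\<close> is a bound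
  for one draw with replacement. The exchange inequality, a midpoint convexity, transfers it
  to draws without replacement.\<close>

lemma subset_average_Suc_le:
  assumes N: "finite N" and s: "s < card N"
    and new: "\<And>U v. U \<subseteq> N \<Longrightarrow> v \<in> N - U \<Longrightarrow> h U v = f (insert v U)"
    and exchange: "\<And>U v w. U \<subseteq> N \<Longrightarrow> v \<in> U \<Longrightarrow> w \<in> U \<Longrightarrow> v \<noteq> w \<Longrightarrow>
      2 * f U \<le> h (U - {w}) v + h (U - {v}) w"
    and step: "\<And>U. U \<subseteq> N \<Longrightarrow> (\<Sum>v\<in>N. h U v) \<le> real (card N) * g * f U"
  shows "subset_average N (Suc s) f \<le> g * subset_average N s f"
proof -
  let ?n = "card N"
  define E where "E s = (\<Sum>U\<in>subsets_of_card N s. f U)" for s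
  have sub: "U \<subseteq> N" "finite U" "card U = r" if "U \<in> subsets_of_card N r" for U r
    using that N finite_subset by (auto simp: subsets_of_card_def)
  have ns: "0 < real ?n - real s" using s by simp
  \<comment> \<open>Draws of a new element: every set of size \<open>Suc s\<close> is reached from
    \<open>Suc s\<close> pairs.\<close>
  have fresh: "(\<Sum>U\<in>subsets_of_card N s. \<Sum>v\<in>N - U. h U v) = real (Suc s) * E (Suc s)"
  proof -
    have "(\<Sum>U\<in>subsets_of_card N s. \<Sum>v\<in>N - U. h U v)
        = (\<Sum>U\<in>subsets_of_card N s. \<Sum>v\<in>N - U. f (insert v U))"
      using new sub by (intro sum.cong) auto
    also have "\<dots> = (\<Sum>U\<in>subsets_of_card N (Suc s). \<Sum>w\<in>U. f (insert w (U - {w})))"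
      by (rule sum_subsets_of_card_remove[OF N])
    also have "\<dots> = (\<Sum>U\<in>subsets_of_card N (Suc s). real (Suc s) * f U)"
      using sub by (intro sum.cong) (auto simp: insert_absorb)
    finally show ?thesis by (simp add: E_def sum_distrib_left)
  qed
  \<comment> \<open>Draws of an element already present: the exchange inequality is summed over the
    ordered pairs of each set of size \<open>Suc s\<close>. The factor \<open>n - s\<close> counts
    the elements \<open>w\<close> outside a set of size \<open>s\<close>.\<close>
  have repeated: "real (Suc s) * real s * E (Suc s)
      \<le> (real ?n - real s) * (\<Sum>U\<in>subsets_of_card N s. \<Sum>v\<in>U. h U v)"
  proof -
    have pair: "real (Suc s) * real s * f U \<le> (\<Sum>w\<in>U. \<Sum>v\<in>U - {w}. h (U - {w}) v)"
      if U: "U \<in> subsets_of_card N (Suc s)" for U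
    proof -
      have "(\<Sum>w\<in>U. \<Sum>v\<in>U - {w}. 2 * f U) = 2 * (real (Suc s) * real s * f U)"
        using sub[OF U] by simp
      moreover have "(\<Sum>w\<in>U. \<Sum>v\<in>U - {w}. 2 * f U)
          \<le> (\<Sum>w\<in>U. \<Sum>v\<in>U - {w}. h (U - {w}) v + h (U - {v}) w)"
        using exchange sub[OF U] by (intro sum_mono) auto
      moreover have "\<dots> = (\<Sum>w\<in>U. \<Sum>v\<in>U - {w}. h (U - {w}) v) + (\<Sum>w\<in>U. \<Sum>v\<in>U - {w}. h (U - {v}) w)"
        by (simp add: sum.distrib)
      moreover have "(\<Sum>w\<in>U. \<Sum>v\<in>U - {w}. h (U - {v}) w) = (\<Sum>w\<in>U. \<Sum>v\<in>U - {w}. h (U - {w}) v)"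
        by (rule sum_ordered_pairs_swap[OF sub(2)[OF U]])
      ultimately show ?thesis by linarith
    qed
    have "real (Suc s) * real s * E (Suc s)
        \<le> (\<Sum>U\<in>subsets_of_card N (Suc s). \<Sum>w\<in>U. \<Sum>v\<in>U - {w}. h (U - {w}) v)"
      unfolding E_def sum_distrib_left by (rule sum_mono) (rule pair)
    also have "\<dots> = (\<Sum>U\<in>subsets_of_card N s. \<Sum>w\<in>N - U. \<Sum>v\<in>U. h U v)"
      by (rule sum_subsets_of_card_remove[OF N, symmetric])
    also have "\<dots> = (\<Sum>U\<in>subsets_of_card N s. (real ?n - real s) * (\<Sum>v\<in>U. h U v))"
      using sub s by (intro sum.cong) (auto simp: card_Diff_subset of_nat_diff)
    finally show ?thesis by (simp add: sum_distrib_left)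
  qed
  have split: "(\<Sum>U\<in>subsets_of_card N s. \<Sum>v\<in>N. h U v)
      = (\<Sum>U\<in>subsets_of_card N s. \<Sum>v\<in>N - U. h U v) + (\<Sum>U\<in>subsets_of_card N s. \<Sum>v\<in>U. h U v)"
    unfolding sum.distrib[symmetric] using N sub(1) by (intro sum.cong) (auto simp: sum.subset_diff)
  have "(\<Sum>U\<in>subsets_of_card N s. \<Sum>v\<in>N. h U v) \<le> real ?n * g * E s"
    unfolding E_def sum_distrib_left using step sub(1) by (intro sum_mono) auto
  then have "real (Suc s) * E (Suc s) + (\<Sum>U\<in>subsets_of_card N s. \<Sum>v\<in>U. h U v) \<le> real ?n * g * E s"
    unfolding split fresh .
  then have "(real ?n - real s) * (real (Suc s) * E (Suc s)) + real (Suc s) * real s * E (Suc s)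
      \<le> (real ?n - real s) * (real ?n * g * E s)"
    using mult_left_mono[of _ "real ?n * g * E s" "real ?n - real s"] ns repeated
    by (smt (verit) distrib_left)
  \<comment> \<open>The coefficients combine as
    \<open>(n - s) (s + 1) + (s + 1) s = n (s + 1)\<close>.\<close>
  then have "real ?n * (real (Suc s) * E (Suc s)) \<le> real ?n * ((real ?n - real s) * (g * E s))"
    by (simp add: algebra_simps)
  then have main: "real (Suc s) * E (Suc s) \<le> (real ?n - real s) * (g * E s)"
    using s by (simp only: mult_le_cancel_left_pos of_nat_0_less_iff)
  \<comment> \<open>This identity turns the bound on sums into a bound on averages.\<close>
  have "Suc s * (?n choose Suc s) = (?n - s) * (?n choose s)"
    by (metis binomial_absorb_comp binomial_absorption mult.commute)
  then have bin: "real (Suc s) * real (?n choose Suc s) = (real ?n - real s) * real (?n choose s)"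
    using s by (metis less_imp_le of_nat_diff of_nat_mult)
  have pos: "0 < real (?n choose s)" "0 < real (?n choose Suc s)" using s by auto
  have "E (Suc s) / real (?n choose Suc s) = real (Suc s) * E (Suc s) / (real (Suc s) * real (?n choose Suc s))"
    by (simp del: of_nat_Suc)
  also have "\<dots> \<le> (real ?n - real s) * (g * E s) / (real (Suc s) * real (?n choose Suc s))"
    using main pos by (intro divide_right_mono) auto
  also have "\<dots> = g * (E s / real (?n choose s))"
    unfolding bin using ns by simp
  finally show ?thesis by (simp add: subset_average_def E_def)
qed

lemma subset_average_le_power:
  assumes N: "finite N" and s: "s \<le> card N"
    and new: "\<And>U v. U \<subseteq> N \<Longrightarrow> v \<in> N - U \<Longrightarrow> h U v = f (insert v U)"
    and exchange: "\<And>U v w. U \<subseteq> N \<Longrightarrow> v \<in> U \<Longrightarrow> w \<in> U \<Longrightarrow> v \<noteq> w \<Longrightarrow>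
      2 * f U \<le> h (U - {w}) v + h (U - {v}) w"
    and step: "\<And>U. U \<subseteq> N \<Longrightarrow> (\<Sum>v\<in>N. h U v) \<le> real (card N) * g * f U"
    and g: "0 \<le> g"
  shows "subset_average N s f \<le> g ^ s * f {}"
  using s
proof (induction s)
  case 0
  have "subsets_of_card N 0 = {{}}"
    using N by (auto simp: subsets_of_card_def card_eq_0_iff dest: finite_subset)
  then show ?case by (simp add: subset_average_def)
next
  case (Suc s)
  have "subset_average N (Suc s) f \<le> g * subset_average N s f"
    using Suc.prems by (intro subset_average_Suc_le[OF N _ new exchange step]) auto
  also have "\<dots> \<le> g * (g ^ s * f {})" using Suc g by (intro mult_left_mono) auto
  finally show ?case by simp
qed

section \<open>Ordered draws as uniformly random subsets\<close>

lemma card_distinct_lists_with_set_in: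
  assumes F: "finite F" and U: "\<And>U. U \<in> F \<Longrightarrow> finite U \<and> card U = m"
  shows "card {xs. length xs = m \<and> distinct xs \<and> set xs \<in> F} = card F * fact m"
proof -
  have "{xs. length xs = m \<and> distinct xs \<and> set xs \<in> F} = (\<Union>U\<in>F. permutations_of_set U)"
    using U by (auto simp: permutations_of_set_def) (metis distinct_card)+
  also have "card \<dots> = (\<Sum>U\<in>F. card (permutations_of_set U))"
    using F by (intro card_UN_disjoint) (auto dest: permutations_of_setD)
  also have "\<dots> = (\<Sum>U\<in>F. fact m)" using U by (intro sum.cong) auto
  finally show ?thesis by simp
qed

text \<open>Every subset of size \<open>m\<close> is listed by \<open>fact m\<close> equally likely
  lists, so the set drawn is uniformly distributed.\<close>

lemma prob_draw_without_replacement_set: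
  assumes m: "m \<le> n"
  shows "measure_pmf.prob (draw_without_replacement n m) {\<omega>. R (set \<omega>)}
    = real (card {U \<in> subsets_of_card {..<n} m. R U}) / real (n choose m)"
proof -
  let ?L = "{xs. length xs = m \<and> distinct xs \<and> set xs \<subseteq> {..<n}}"
  have card: "card {xs. length xs = m \<and> distinct xs \<and> set xs \<in> F} = card F * fact m"
    if "F \<subseteq> subsets_of_card {..<n} m" for F
    using that finite_subset[OF that]
    by (intro card_distinct_lists_with_set_in) (auto simp: subsets_of_card_def finite_subset)
  have L: "?L = {xs. length xs = m \<and> distinct xs \<and> set xs \<in> subsets_of_card {..<n} m}"
    by (auto simp: subsets_of_card_def distinct_card)
  have cL: "card ?L = (n choose m) * fact m"
    unfolding L by (subst card) (auto simp: card_subsets_of_card)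
  then have "0 < card ?L" using m by simp
  then have ne: "?L \<noteq> {}" "finite ?L" by (auto simp: card_gt_0_iff)
  have "?L \<inter> {\<omega>. R (set \<omega>)}
      = {xs. length xs = m \<and> distinct xs \<and> set xs \<in> {U \<in> subsets_of_card {..<n} m. R U}}"
    by (auto simp: subsets_of_card_def distinct_card)
  then have "card (?L \<inter> {\<omega>. R (set \<omega>)}) = card {U \<in> subsets_of_card {..<n} m. R U} * fact m"
    by (simp only:) (rule card, auto)
  then show ?thesis
    unfolding draw_without_replacement_def measure_pmf_of_set[OF ne] cL by simp
qed

lemma prob_draw_without_replacement_markov:
  assumes m: "m \<le> n" and f: "\<And>U. U \<subseteq> {..<n} \<Longrightarrow> 0 \<le> f U"
    and R: "\<And>U. U \<subseteq> {..<n} \<Longrightarrow> card U = m \<Longrightarrow> R U \<Longrightarrow> b \<le> f U" and b: "0 < b"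
  shows "measure_pmf.prob (draw_without_replacement n m) {\<omega>. R (set \<omega>)}
    \<le> subset_average {..<n} m f / b"
proof -
  let ?S = "subsets_of_card {..<n} m"
  have "b * real (card {U \<in> ?S. R U}) = (\<Sum>U\<in>{U \<in> ?S. R U}. b)" by simp
  also have "\<dots> \<le> (\<Sum>U\<in>{U \<in> ?S. R U}. f U)"
    using R by (intro sum_mono) (auto simp: subsets_of_card_def)
  also have "\<dots> \<le> (\<Sum>U\<in>?S. f U)"
    using f by (intro sum_mono2) (auto simp: subsets_of_card_def)
  finally have "real (card {U \<in> ?S. R U}) \<le> (\<Sum>U\<in>?S. f U) / b"
    using b by (simp add: field_simps)
  then have "real (card {U \<in> ?S. R U}) / real (n choose m) \<le> (\<Sum>U\<in>?S. f U) / b / real (n choose m)"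
    by (rule divide_right_mono) simp
  then show ?thesis
    unfolding prob_draw_without_replacement_set[OF m] subset_average_def by (simp add: mult.commute)
qed

section \<open>Tail bounds for Parseval frames\<close>

lemma tr_mat_smult: "A \<in> carrier_mat k k \<Longrightarrow> tr_mat (s \<cdot>\<^sub>m A) = s * tr_mat A"
  by (auto simp: tr_mat_def sum_distrib_left)

text \<open>The tangent inequality with its base point at the updated matrix \<open>G\<close>, since
  \<open>tr (G^(m-1) W)\<close> is \<open>tr (G^m)\<close> minus \<open>s\<close> times the form of
  \<open>G^(m-1)\<close> at \<open>v\<close>. \<open>s\<close> may have either sign, so both tails
  can use it.\<close>

lemma tr_mat_rank1_update_le:
  assumes W: "psd_mat k W" and v: "v \<in> carrier_vec k"
    and W': "psd_mat k (W + s \<cdot>\<^sub>m rank1_mat k v)" and odd: "odd m"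
  shows "tr_mat ((W + s \<cdot>\<^sub>m rank1_mat k v) ^\<^sub>m m)
    \<le> tr_mat (W ^\<^sub>m m) + real m * s * (v \<bullet> ((W + s \<cdot>\<^sub>m rank1_mat k v) ^\<^sub>m (m - 1) *\<^sub>v v))"
proof -
  define G where "G = W + s \<cdot>\<^sub>m rank1_mat k v"
  note Wc = psd_mat_carrier[OF W] and Gc = psd_mat_carrier[OF W', folded G_def]
  note Pc = pow_carrier_mat[OF Gc, of "m - 1"]
  have m: "m = Suc (m - 1)" using odd by (cases m) auto
  have "G ^\<^sub>m m = G ^\<^sub>m (m - 1) * G" by (subst m) simp
  also have "\<dots> = G ^\<^sub>m (m - 1) * W + G ^\<^sub>m (m - 1) * (s \<cdot>\<^sub>m rank1_mat k v)"
    by (subst (2) G_def) (rule mult_add_distrib_mat[OF Pc Wc], simp)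
  also have "G ^\<^sub>m (m - 1) * (s \<cdot>\<^sub>m rank1_mat k v) = s \<cdot>\<^sub>m (G ^\<^sub>m (m - 1) * rank1_mat k v)"
    by (rule mult_smult_distrib[OF Pc rank1_mat_carrier])
  finally have "tr_mat (G ^\<^sub>m m) = tr_mat (G ^\<^sub>m (m - 1) * W) + tr_mat (s \<cdot>\<^sub>m (G ^\<^sub>m (m - 1) * rank1_mat k v))"
    using Pc Wc by (simp add: tr_mat_add[of _ k] mult_carrier_mat[of _ k k])
  also have "tr_mat (s \<cdot>\<^sub>m (G ^\<^sub>m (m - 1) * rank1_mat k v)) = s * tr_mat (G ^\<^sub>m (m - 1) * rank1_mat k v)"
    by (rule tr_mat_smult[OF mult_carrier_mat[OF Pc rank1_mat_carrier]])
  also have "\<dots> = s * (v \<bullet> (G ^\<^sub>m (m - 1) *\<^sub>v v))" by (simp only: tr_mat_mult_rank1[OF Pc v])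
  finally have "real m * tr_mat (G ^\<^sub>m m)
      = real m * tr_mat (G ^\<^sub>m (m - 1) * W) + real m * s * (v \<bullet> (G ^\<^sub>m (m - 1) *\<^sub>v v))"
    by (simp add: algebra_simps)
  then show ?thesis
    using tr_mat_pow_tangent[OF W'[folded G_def] W odd] unfolding G_def[symmetric]
    by (simp add: algebra_simps)
qed

lemma tr_psd_nonneg: "psd_mat k P \<Longrightarrow> 0 \<le> tr_mat P"
  unfolding tr_mat_eq_sum_form[OF psd_mat_carrier] by (intro sum_nonneg psd_mat_nonneg) auto

section \<open>Parseval frames and weighted frame operators\<close>

text \<open>\<open>parseval\<close> is the entrywise form of
  \<open>sum V_i V_i^T = 1\<close>.\<close>

locale parseval_frame =
  fixes k n :: nat and V :: "nat \<Rightarrow> real vec"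
  assumes V [simp]: "i < n \<Longrightarrow> V i \<in> carrier_vec k"
    and parseval: "a < k \<Longrightarrow> b < k \<Longrightarrow> (\<Sum>i<n. V i $ a * V i $ b) = (if a = b then 1 else 0)"
begin

text \<open>Both sides are \<open>tr (M (sum V_i V_i^T))\<close>. This evaluates the sum over one
  uniformly drawn index.\<close>

lemma sum_form_eq_tr_mat:
  assumes M: "M \<in> carrier_mat k k"
  shows "(\<Sum>i<n. V i \<bullet> (M *\<^sub>v V i)) = tr_mat M"
proof -
  have "(\<Sum>i<n. V i \<bullet> (M *\<^sub>v V i)) = (\<Sum>i<n. \<Sum>a<k. \<Sum>b<k. M $$ (a, b) * (V i $ a * V i $ b))"
  proof (rule sum.cong[OF refl])
    fix i assume "i \<in> {..<n}"
    then have "V i \<in> carrier_vec k" by simp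
    then show "V i \<bullet> (M *\<^sub>v V i) = (\<Sum>a<k. \<Sum>b<k. M $$ (a, b) * (V i $ a * V i $ b))"
      using M by (auto simp: form_eq_entries[OF M] scalar_prod_def sum_distrib_left lessThan_atLeast0
          mult_ac intro!: sum.cong)
  qed
  also have "\<dots> = (\<Sum>a<k. \<Sum>b<k. M $$ (a, b) * (\<Sum>i<n. V i $ a * V i $ b))"
    by (subst sum.swap) (simp add: sum.swap[of _ "{..<n}"] sum_distrib_left)
  also have "\<dots> = (\<Sum>a<k. \<Sum>b<k. if a = b then M $$ (a, b) else 0)"
    by (intro sum.cong refl) (simp add: parseval)
  also have "\<dots> = tr_mat M" using M by (simp add: tr_mat_def)
  finally show ?thesis .
qed

lemma sum_sq_eq:
  assumes x: "x \<in> carrier_vec k"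
  shows "(\<Sum>i<n. (V i \<bullet> x)\<^sup>2) = x \<bullet> x"
proof -
  have "(\<Sum>i<n. (V i \<bullet> x)\<^sup>2) = (\<Sum>i<n. V i \<bullet> (rank1_mat k x *\<^sub>v V i))"
  proof (rule sum.cong[OF refl])
    fix i assume "i \<in> {..<n}"
    then have Vi: "V i \<in> carrier_vec k" by simp
    show "(V i \<bullet> x)\<^sup>2 = V i \<bullet> (rank1_mat k x *\<^sub>v V i)"
      unfolding rank1_mat_mult_vec[OF x Vi] using x Vi comm_scalar_prod[OF x Vi]
      by (simp add: scalar_prod_smult_distrib[of _ k] power2_eq_square)
  qed
  also have "\<dots> = tr_mat (rank1_mat k x)" by (rule sum_form_eq_tr_mat) simp
  also have "\<dots> = x \<bullet> x" using x by (simp add: tr_mat_def rank1_mat_def scalar_prod_def lessThan_atLeast0)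
  finally show ?thesis .
qed

text \<open>The matrix \<open>1 + sum w_i V_i V_i^T\<close>. Weights on all indices, instead of an
  index set, allow an index to be drawn twice.\<close>

definition weighted_mat :: "(nat \<Rightarrow> real) \<Rightarrow> real mat" where
  "weighted_mat w = mat k k (\<lambda>(a, b). (if a = b then 1 else 0) + (\<Sum>i<n. w i * (V i $ a * V i $ b)))"

lemma weighted_mat_carrier [simp]: "weighted_mat w \<in> carrier_mat k k"
  by (simp add: weighted_mat_def)

lemma weighted_mat_update:
  assumes "v < n"
  shows "weighted_mat (w(v := w v + s)) = weighted_mat w + s \<cdot>\<^sub>m rank1_mat k (V v)"
proof (rule eq_matI)
  fix a b assume ab: "a < dim_row (weighted_mat w + s \<cdot>\<^sub>m rank1_mat k (V v))"
    "b < dim_col (weighted_mat w + s \<cdot>\<^sub>m rank1_mat k (V v))"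
  have "(\<Sum>i<n. (w(v := w v + s)) i * (V i $ a * V i $ b))
      = (\<Sum>i<n. w i * (V i $ a * V i $ b) + (if i = v then s * (V v $ a * V v $ b) else 0))"
    by (intro sum.cong) (auto simp: algebra_simps)
  also have "\<dots> = (\<Sum>i<n. w i * (V i $ a * V i $ b)) + s * (V v $ a * V v $ b)"
    using assms by (simp add: sum.distrib)
  finally show "weighted_mat (w(v := w v + s)) $$ (a, b) = (weighted_mat w + s \<cdot>\<^sub>m rank1_mat k (V v)) $$ (a, b)"
    using ab by (simp add: weighted_mat_def rank1_mat_def del: fun_upd_apply)
qed (simp_all add: weighted_mat_def rank1_mat_def)

lemma weighted_mat_form:
  assumes y: "y \<in> carrier_vec k"
  shows "y \<bullet> (weighted_mat w *\<^sub>v y) = y \<bullet> y + (\<Sum>i<n. w i * (V i \<bullet> y)\<^sup>2)"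
proof -
  have Vy: "V i \<bullet> y = (\<Sum>a<k. V i $ a * y $ a)" for i
    using y by (simp add: scalar_prod_def lessThan_atLeast0)
  have row: "(weighted_mat w *\<^sub>v y) $ a = y $ a + (\<Sum>i<n. w i * V i $ a * (V i \<bullet> y))" if a: "a < k" for a
  proof -
    have "(weighted_mat w *\<^sub>v y) $ a
        = (\<Sum>b<k. ((if a = b then 1 else 0) + (\<Sum>i<n. w i * (V i $ a * V i $ b))) * y $ b)"
      using a y by (simp add: weighted_mat_def scalar_prod_def lessThan_atLeast0)
    also have "\<dots> = (\<Sum>b<k. (if a = b then y $ b else 0)) + (\<Sum>b<k. \<Sum>i<n. w i * (V i $ a * V i $ b) * y $ b)"
      unfolding sum.distrib[symmetric]
      by (intro sum.cong) (auto simp: distrib_right sum_distrib_right)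
    also have "(\<Sum>b<k. if a = b then y $ b else 0) = y $ a" using a by simp
    also have "(\<Sum>b<k. \<Sum>i<n. w i * (V i $ a * V i $ b) * y $ b) = (\<Sum>i<n. w i * V i $ a * (V i \<bullet> y))"
      unfolding Vy sum_distrib_left by (subst sum.swap) (simp add: mult_ac)
    finally show ?thesis .
  qed
  have "y \<bullet> (weighted_mat w *\<^sub>v y)
      = (\<Sum>a<k. y $ a * y $ a) + (\<Sum>a<k. \<Sum>i<n. y $ a * (w i * V i $ a * (V i \<bullet> y)))"
    unfolding form_eq_entries[OF weighted_mat_carrier y] sum.distrib[symmetric]
    by (intro sum.cong) (auto simp: row distrib_left sum_distrib_left)
  also have "(\<Sum>a<k. \<Sum>i<n. y $ a * (w i * V i $ a * (V i \<bullet> y)))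
      = (\<Sum>i<n. \<Sum>a<k. w i * (V i \<bullet> y) * (V i $ a * y $ a))"
    by (subst sum.swap) (simp add: mult_ac)
  also have "\<dots> = (\<Sum>i<n. w i * (V i \<bullet> y) * (V i \<bullet> y))"
    unfolding sum_distrib_left[symmetric] Vy[symmetric] ..
  finally show ?thesis
    using y by (simp add: scalar_prod_def[of y y] lessThan_atLeast0 power2_eq_square mult.assoc)
qed

lemma weighted_mat_form_ge:
  assumes y: "y \<in> carrier_vec k" and w: "\<And>i. i < n \<Longrightarrow> - b \<le> w i"
  shows "(1 - b) * (y \<bullet> y) \<le> y \<bullet> (weighted_mat w *\<^sub>v y)"
proof -
  have "- b * (y \<bullet> y) = (\<Sum>i<n. - b * (V i \<bullet> y)\<^sup>2)"
    by (simp only: sum_sq_eq[OF y, symmetric] sum_distrib_left)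
  also have "\<dots> \<le> (\<Sum>i<n. w i * (V i \<bullet> y)\<^sup>2)"
    using w by (intro sum_mono mult_right_mono) auto
  finally show ?thesis unfolding weighted_mat_form[OF y] by (simp add: algebra_simps)
qed

lemma weighted_mat_form_le:
  assumes y: "y \<in> carrier_vec k" and w: "\<And>i. i < n \<Longrightarrow> w i \<le> 0"
  shows "y \<bullet> (weighted_mat w *\<^sub>v y) \<le> y \<bullet> y"
  unfolding weighted_mat_form[OF y] using w by (auto intro!: sum_nonpos mult_nonpos_nonneg)

lemma psd_weighted_mat:
  assumes "\<And>i. i < n \<Longrightarrow> - 1 \<le> w i"
  shows "psd_mat k (weighted_mat w)"
proof -
  have "transpose_mat (weighted_mat w) = weighted_mat w"
    by (rule eq_matI) (auto simp: weighted_mat_def mult_ac)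
  then show ?thesis using weighted_mat_form_ge[of _ 1 w] assms by (auto simp: psd_mat_def)
qed

text \<open>The two tangent inequalities based at \<open>w\<close> are added; their linear terms
  combine because the matrices of \<open>w1\<close> and \<open>w2\<close> sum to twice that of
  \<open>w\<close>.\<close>

lemma tr_weighted_mat_midpoint:
  assumes w: "\<And>i. i < n \<Longrightarrow> - 1 \<le> w i" and w1: "\<And>i. i < n \<Longrightarrow> - 1 \<le> w1 i"
    and w2: "\<And>i. i < n \<Longrightarrow> - 1 \<le> w2 i"
    and mid: "\<And>i. i < n \<Longrightarrow> w1 i + w2 i = 2 * w i" and odd: "odd m"
  shows "2 * tr_mat (weighted_mat w ^\<^sub>m m) \<le> tr_mat (weighted_mat w1 ^\<^sub>m m) + tr_mat (weighted_mat w2 ^\<^sub>m m)"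
proof -
  define P where "P = weighted_mat w ^\<^sub>m (m - 1)"
  have P: "P \<in> carrier_mat k k" unfolding P_def by (rule pow_carrier_mat) simp
  have m: "m = Suc (m - 1)" using odd by (cases m) auto
  have "weighted_mat w1 + weighted_mat w2 = weighted_mat w + weighted_mat w"
  proof (rule eq_matI)
    fix a b
    assume ab: "a < dim_row (weighted_mat w + weighted_mat w)" "b < dim_col (weighted_mat w + weighted_mat w)"
    have "(\<Sum>i<n. w1 i * (V i $ a * V i $ b)) + (\<Sum>i<n. w2 i * (V i $ a * V i $ b))
        = (\<Sum>i<n. w i * (V i $ a * V i $ b)) + (\<Sum>i<n. w i * (V i $ a * V i $ b))"
      unfolding sum.distrib[symmetric] distrib_right[symmetric] using mid by (intro sum.cong) auto
    then show "(weighted_mat w1 + weighted_mat w2) $$ (a, b) = (weighted_mat w + weighted_mat w) $$ (a, b)"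
      using ab by (simp add: weighted_mat_def)
  qed (simp_all add: weighted_mat_def)
  then have "tr_mat (P * (weighted_mat w1 + weighted_mat w2)) = tr_mat (P * (weighted_mat w + weighted_mat w))"
    by simp
  then have sum: "tr_mat (P * weighted_mat w1) + tr_mat (P * weighted_mat w2) = 2 * tr_mat (P * weighted_mat w)"
    unfolding mult_add_distrib_mat[OF P weighted_mat_carrier weighted_mat_carrier]
      tr_mat_add[OF mult_carrier_mat[OF P weighted_mat_carrier] mult_carrier_mat[OF P weighted_mat_carrier]]
    by simp
  have Pw: "P * weighted_mat w = weighted_mat w ^\<^sub>m m" unfolding P_def by (subst (2) m) simp
  have "real m * tr_mat (P * weighted_mat w1) + real m * tr_mat (P * weighted_mat w2)
      = 2 * (real m * tr_mat (weighted_mat w ^\<^sub>m m))"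
    unfolding distrib_left[symmetric] sum Pw by simp
  moreover have "real m * tr_mat (P * weighted_mat w1)
      \<le> (real m - 1) * tr_mat (weighted_mat w ^\<^sub>m m) + tr_mat (weighted_mat w1 ^\<^sub>m m)"
    unfolding P_def using w w1 by (intro tr_mat_pow_tangent[of k] psd_weighted_mat odd) auto
  moreover have "real m * tr_mat (P * weighted_mat w2)
      \<le> (real m - 1) * tr_mat (weighted_mat w ^\<^sub>m m) + tr_mat (weighted_mat w2 ^\<^sub>m m)"
    unfolding P_def using w w2 by (intro tr_mat_pow_tangent[of k] psd_weighted_mat odd) auto
  ultimately show ?thesis by (simp add: left_diff_distrib)
qed

definition sample_weight :: "real \<Rightarrow> nat set \<Rightarrow> nat \<Rightarrow> real" where
  "sample_weight \<tau> U i = (if i \<in> U then \<tau> else 0)"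

text \<open>With \<open>\<tau> = \<plusminus> \<theta> / m\<close> this stands in for a trace
  exponential; the identity inside \<open>weighted_mat\<close> makes it the \<open>m\<close>-th
  power in the Euler limit.\<close>

definition tr_pow :: "nat \<Rightarrow> real \<Rightarrow> nat set \<Rightarrow> real" where
  "tr_pow m \<tau> U = tr_mat (weighted_mat (sample_weight \<tau> U) ^\<^sub>m m)"

lemma psd_sample: "- 1 \<le> \<tau> \<Longrightarrow> psd_mat k (weighted_mat (sample_weight \<tau> U))"
  by (rule psd_weighted_mat) (auto simp: sample_weight_def)

lemma tr_pow_nonneg: "- 1 \<le> \<tau> \<Longrightarrow> 0 \<le> tr_pow m \<tau> U"
  unfolding tr_pow_def by (rule tr_psd_nonneg[OF psd_pow_mat[OF psd_sample]])

lemma tr_pow_empty: "tr_pow m \<tau> {} = real k"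
proof -
  have "weighted_mat (sample_weight \<tau> {}) = 1\<^sub>m k"
    by (rule eq_matI) (auto simp: weighted_mat_def sample_weight_def)
  moreover have "1\<^sub>m k ^\<^sub>m m = (1\<^sub>m k :: real mat)" by (induction m) auto
  ultimately show ?thesis by (simp add: tr_pow_def tr_mat_def)
qed

text \<open>The bound \<open>- 1 / 2 \<le> \<tau>\<close> keeps the matrices positive semidefinite
  when an index is drawn twice and carries weight \<open>2 * \<tau>\<close>.\<close>

lemma subset_average_tr_pow_le:
  assumes \<tau>: "- 1 / 2 \<le> \<tau>" and odd: "odd m" and \<rho>: "\<rho> \<le> n" and g: "0 \<le> g"
    and step: "\<And>U. U \<subseteq> {..<n} \<Longrightarrow>
      (\<Sum>v<n. tr_mat ((weighted_mat (sample_weight \<tau> U) + \<tau> \<cdot>\<^sub>m rank1_mat k (V v)) ^\<^sub>m m))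
        \<le> real n * g * tr_pow m \<tau> U"
  shows "subset_average {..<n} \<rho> (tr_pow m \<tau>) \<le> g ^ \<rho> * real k"
proof -
  \<comment> \<open>\<open>\<tau>\<close> is added even if \<open>v\<close> already lies in
    \<open>U\<close>, so \<open>h\<close> describes a draw with replacement.\<close>
  define h where "h U v = tr_mat (weighted_mat ((sample_weight \<tau> U)(v := sample_weight \<tau> U v + \<tau>)) ^\<^sub>m m)" for U v
  have "subset_average {..<n} \<rho> (tr_pow m \<tau>) \<le> g ^ \<rho> * tr_pow m \<tau> {}"
  proof (rule subset_average_le_power[where h = h])
    fix U v assume "v \<in> {..<n} - U"
    then have "(sample_weight \<tau> U)(v := sample_weight \<tau> U v + \<tau>) = sample_weight \<tau> (insert v U)"
      by (auto simp: sample_weight_def)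
    then show "h U v = tr_pow m \<tau> (insert v U)" by (simp add: h_def tr_pow_def)
  next
    fix U v w assume "U \<subseteq> {..<n}" "v \<in> U" "w \<in> U" "v \<noteq> w"
    \<comment> \<open>Trading \<open>w\<close> for a second copy of \<open>v\<close>, or
      \<open>v\<close> for a second copy of \<open>w\<close>, gives weights whose midpoint is
      \<open>sample_weight \<tau> U\<close>.\<close>
    then show "2 * tr_pow m \<tau> U \<le> h (U - {w}) v + h (U - {v}) w"
      unfolding tr_pow_def h_def using \<tau>
      by (intro tr_weighted_mat_midpoint odd) (auto simp: sample_weight_def)
  next
    fix U assume U: "U \<subseteq> {..<n}"
    show "(\<Sum>v<n. h U v) \<le> real (card {..<n}) * g * tr_pow m \<tau> U"
      using step[OF U] by (simp add: h_def weighted_mat_update)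
  qed (use \<rho> g in auto)
  then show ?thesis by (simp add: tr_pow_empty)
qed

end

section \<open>Bounds for one draw and the limit of odd exponents\<close>

lemma power_one_plus_le_exp:
  assumes "0 \<le> (x :: real)" "x \<le> y"
  shows "(1 + x) ^ (m - 1) \<le> exp (real m * y)"
proof -
  have "(1 + x) ^ (m - 1) \<le> exp x ^ (m - 1)"
    using assms by (intro power_mono) auto
  also have "\<dots> = exp (real (m - 1) * x)" by (simp add: exp_of_nat_mult)
  also have "\<dots> \<le> exp (real m * y)"
    using assms by (auto intro!: mult_mono)
  finally show ?thesis .
qed

text \<open>The trace inequalities are established for odd exponents, so limits are taken along
  \<open>2 * q + 1\<close>.\<close>

lemma strict_mono_odd: "strict_mono (\<lambda>q :: nat. 2 * q + 1)"
  by (rule strict_monoI) simp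

lemma tendsto_exp_limit_odd: "(\<lambda>q. (1 + x / real (2 * q + 1)) ^ (2 * q + 1)) \<longlonglongrightarrow> exp x"
  using LIMSEQ_subseq_LIMSEQ[OF tendsto_exp_limit_sequentially strict_mono_odd] unfolding o_def .

context parseval_frame
begin

lemma sum_sample_weight:
  assumes "U \<subseteq> {..<n}"
  shows "(\<Sum>i<n. sample_weight \<tau> U i * F i) = \<tau> * (\<Sum>i\<in>U. F i)"
proof -
  have "(\<Sum>i<n. sample_weight \<tau> U i * F i) = (\<Sum>i\<in>U. sample_weight \<tau> U i * F i)"
    using assms by (intro sum.mono_neutral_right) (auto simp: sample_weight_def)
  also have "\<dots> = \<tau> * (\<Sum>i\<in>U. F i)" by (simp add: sample_weight_def sum_distrib_left)
  finally show ?thesis .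
qed

text \<open>The cost of an update is a form of the updated matrix at \<open>V v\<close>. As
  \<open>W\<close> dominates the identity, the rank-one comparison with \<open>a = 1\<close> leads
  back to \<open>W\<close>; summing over \<open>v\<close> gives \<open>tr (W^(m-1))\<close>, which
  is at most \<open>tr (W^m)\<close>.\<close>

lemma sum_tr_update_pos_le:
  assumes \<tau>: "0 \<le> \<tau>" and odd: "odd m" and R: "\<And>i. i < n \<Longrightarrow> V i \<bullet> V i \<le> R"
  shows "(\<Sum>v<n. tr_mat ((weighted_mat (sample_weight \<tau> U) + \<tau> \<cdot>\<^sub>m rank1_mat k (V v)) ^\<^sub>m m))
    \<le> (real n + real m * \<tau> * exp (real m * (\<tau> * R))) * tr_pow m \<tau> U"
proof -
  define W where "W = weighted_mat (sample_weight \<tau> U)"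
  define c where "c = real m * \<tau> * exp (real m * (\<tau> * R))"
  have c: "0 \<le> c" using \<tau> by (simp add: c_def)
  have W: "psd_mat k W" unfolding W_def using \<tau> by (intro psd_sample) auto
  have Wge: "1 * (y \<bullet> y) \<le> y \<bullet> (W *\<^sub>v y)" if "y \<in> carrier_vec k" for y
    using weighted_mat_form_ge[OF that, of 0 "sample_weight \<tau> U"] \<tau>
    by (auto simp: W_def sample_weight_def)
  have m: "Suc (m - 1) = m" using odd by (cases m) auto
  have "tr_mat ((W + \<tau> \<cdot>\<^sub>m rank1_mat k (V v)) ^\<^sub>m m)
      \<le> tr_mat (W ^\<^sub>m m) + c * (V v \<bullet> (W ^\<^sub>m (m - 1) *\<^sub>v V v))" if v: "v < n" for v
  proof -
    have Vv: "V v \<in> carrier_vec k" using v by simp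
    have r: "0 \<le> V v \<bullet> V v" unfolding scalar_prod_def by (intro sum_nonneg) (rule zero_le_square)
    have W': "psd_mat k (W + \<tau> \<cdot>\<^sub>m rank1_mat k (V v))"
      unfolding W_def weighted_mat_update[OF v, symmetric]
      using \<tau> by (intro psd_weighted_mat) (auto simp: sample_weight_def)
    have "tr_mat ((W + \<tau> \<cdot>\<^sub>m rank1_mat k (V v)) ^\<^sub>m m)
        \<le> tr_mat (W ^\<^sub>m m) + real m * \<tau> * (V v \<bullet> ((W + \<tau> \<cdot>\<^sub>m rank1_mat k (V v)) ^\<^sub>m (m - 1) *\<^sub>v V v))"
      by (rule tr_mat_rank1_update_le[OF W Vv W' odd])
    also have "\<dots> \<le> tr_mat (W ^\<^sub>m m) + real m * \<tau> *
        ((1 + \<tau> * (V v \<bullet> V v) / 1) ^ (m - 1) * (V v \<bullet> (W ^\<^sub>m (m - 1) *\<^sub>v V v)))"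
      using \<tau> by (intro add_left_mono mult_left_mono rank1_update_form_le[OF W Vv \<tau> _ Wge[OF Vv]]) auto
    also have "\<dots> \<le> tr_mat (W ^\<^sub>m m) + real m * \<tau> *
        (exp (real m * (\<tau> * R)) * (V v \<bullet> (W ^\<^sub>m (m - 1) *\<^sub>v V v)))"
      using \<tau> r R[OF v] psd_mat_nonneg[OF psd_pow_mat[OF W] Vv]
        power_one_plus_le_exp[of "\<tau> * (V v \<bullet> V v)" "\<tau> * R" m]
      by (intro add_left_mono mult_left_mono mult_right_mono) (auto simp: mult_left_mono)
    finally show ?thesis by (simp add: c_def mult.assoc)
  qed
  then have "(\<Sum>v<n. tr_mat ((W + \<tau> \<cdot>\<^sub>m rank1_mat k (V v)) ^\<^sub>m m))
      \<le> (\<Sum>v<n. tr_mat (W ^\<^sub>m m) + c * (V v \<bullet> (W ^\<^sub>m (m - 1) *\<^sub>v V v)))"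
    by (intro sum_mono) auto
  also have "\<dots> = real n * tr_mat (W ^\<^sub>m m) + c * tr_mat (W ^\<^sub>m (m - 1))"
    using sum_form_eq_tr_mat[OF pow_carrier_mat[OF psd_mat_carrier[OF W]], of "m - 1"]
    by (simp add: sum.distrib sum_distrib_left[symmetric])
  also have "\<dots> \<le> real n * tr_mat (W ^\<^sub>m m) + c * tr_mat (W ^\<^sub>m m)"
  proof (intro add_left_mono mult_left_mono[OF _ c])
    have "tr_mat (W ^\<^sub>m (m - 1)) \<le> tr_mat (W ^\<^sub>m Suc (m - 1))"
      unfolding tr_mat_eq_sum_form[OF pow_carrier_mat[OF psd_mat_carrier[OF W]]]
    proof (rule sum_mono)
      fix i
      have "1 * (unit_vec k i \<bullet> (W ^\<^sub>m (m - 1) *\<^sub>v unit_vec k i))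
          \<le> unit_vec k i \<bullet> (W ^\<^sub>m Suc (m - 1) *\<^sub>v unit_vec k i)"
      proof (rule psd_form_pow_Suc_ge[OF W unit_vec_carrier])
        show "1 * (unit_vec k i \<bullet> unit_vec k i) \<le> unit_vec k i \<bullet> (W *\<^sub>v unit_vec k i)"
          by (rule Wge) (rule unit_vec_carrier)
      qed simp
      then show "unit_vec k i \<bullet> (W ^\<^sub>m (m - 1) *\<^sub>v unit_vec k i)
          \<le> unit_vec k i \<bullet> (W ^\<^sub>m Suc (m - 1) *\<^sub>v unit_vec k i)" by (simp only: mult_1)
    qed
    then show "tr_mat (W ^\<^sub>m (m - 1)) \<le> tr_mat (W ^\<^sub>m m)" by (simp only: m)
  qed
  finally show ?thesis by (simp add: W_def c_def tr_pow_def distrib_right)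
qed

text \<open>The decrease must be bounded from below, so the comparison is reversed: \<open>W\<close>
  is the updated matrix plus \<open>\<sigma> v v^T\<close>. Since the identity dominates
  \<open>W\<close>, also \<open>tr (W^m) \<le> tr (W^(m-1))\<close>.\<close>

lemma sum_tr_update_neg_le:
  assumes \<sigma>: "0 \<le> \<sigma>" "\<sigma> < 1 / 2" and odd: "odd m" and R: "\<And>i. i < n \<Longrightarrow> V i \<bullet> V i \<le> R"
  shows "(\<Sum>v<n. tr_mat ((weighted_mat (sample_weight (- \<sigma>) U) + (- \<sigma>) \<cdot>\<^sub>m rank1_mat k (V v)) ^\<^sub>m m))
    \<le> (real n - real m * \<sigma> * exp (- (real m * (\<sigma> * R / (1 - 2 * \<sigma>))))) * tr_pow m (- \<sigma>) U"
proof -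
  define W where "W = weighted_mat (sample_weight (- \<sigma>) U)"
  \<comment> \<open>An index drawn twice has weight \<open>- 2 * \<sigma>\<close>, so the form of
    the updated matrix is bounded below by \<open>1 - 2 * \<sigma>\<close>.\<close>
  define a where "a = 1 - 2 * \<sigma>"
  define e where "e = real m * (\<sigma> * R / a)"
  define c where "c = real m * \<sigma> * exp (- e)"
  have a: "0 < a" using \<sigma> by (simp add: a_def)
  have c: "0 \<le> c" using \<sigma> by (simp add: c_def)
  have W: "psd_mat k W" unfolding W_def using \<sigma> by (intro psd_sample) auto
  have Wle: "y \<bullet> (W *\<^sub>v y) \<le> y \<bullet> y" if "y \<in> carrier_vec k" for y
    unfolding W_def using \<sigma> by (intro weighted_mat_form_le[OF that]) (auto simp: sample_weight_def)
  have m: "Suc (m - 1) = m" using odd by (cases m) auto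
  have "tr_mat ((W + (- \<sigma>) \<cdot>\<^sub>m rank1_mat k (V v)) ^\<^sub>m m)
      \<le> tr_mat (W ^\<^sub>m m) - c * (V v \<bullet> (W ^\<^sub>m (m - 1) *\<^sub>v V v))" if v: "v < n" for v
  proof -
    have Vv: "V v \<in> carrier_vec k" using v by simp
    have r: "0 \<le> V v \<bullet> V v" unfolding scalar_prod_def by (intro sum_nonneg) (rule zero_le_square)
    define W' where "W' = W + (- \<sigma>) \<cdot>\<^sub>m rank1_mat k (V v)"
    have W'eq: "W' = weighted_mat ((sample_weight (- \<sigma>) U)(v := sample_weight (- \<sigma>) U v + (- \<sigma>)))"
      unfolding W'_def W_def by (rule weighted_mat_update[OF v, symmetric])
    have W': "psd_mat k W'"
      unfolding W'eq using \<sigma> by (intro psd_weighted_mat) (auto simp: sample_weight_def)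
    have W'ge: "a * (V v \<bullet> V v) \<le> V v \<bullet> (W' *\<^sub>v V v)"
      unfolding W'eq a_def using \<sigma> by (intro weighted_mat_form_ge[OF Vv]) (auto simp: sample_weight_def)
    have WW': "W = W' + \<sigma> \<cdot>\<^sub>m rank1_mat k (V v)"
      unfolding W'_def using psd_mat_carrier[OF W] by (intro eq_matI) (auto simp: rank1_mat_def)
    have form: "V v \<bullet> (W ^\<^sub>m (m - 1) *\<^sub>v V v) \<le> exp e * (V v \<bullet> (W' ^\<^sub>m (m - 1) *\<^sub>v V v))"
    proof -
      have "V v \<bullet> (W ^\<^sub>m (m - 1) *\<^sub>v V v)
          \<le> (1 + \<sigma> * (V v \<bullet> V v) / a) ^ (m - 1) * (V v \<bullet> (W' ^\<^sub>m (m - 1) *\<^sub>v V v))"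
        by (subst WW') (rule rank1_update_form_le[OF W' Vv \<sigma>(1) a W'ge])
      also have "\<dots> \<le> exp e * (V v \<bullet> (W' ^\<^sub>m (m - 1) *\<^sub>v V v))"
        unfolding e_def using \<sigma> a r R[OF v] psd_mat_nonneg[OF psd_pow_mat[OF W'] Vv]
        by (intro mult_right_mono power_one_plus_le_exp)
          (auto intro!: divide_right_mono mult_left_mono)
      finally show ?thesis .
    qed
    have "tr_mat (W' ^\<^sub>m m)
        \<le> tr_mat (W ^\<^sub>m m) + real m * (- \<sigma>) * (V v \<bullet> (W' ^\<^sub>m (m - 1) *\<^sub>v V v))"
      unfolding W'_def by (rule tr_mat_rank1_update_le[OF W Vv W'[unfolded W'_def] odd])
    moreover have "c * (V v \<bullet> (W ^\<^sub>m (m - 1) *\<^sub>v V v)) \<le> c * (exp e * (V v \<bullet> (W' ^\<^sub>m (m - 1) *\<^sub>v V v)))"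
      by (rule mult_left_mono[OF form c])
    moreover have "c * (exp e * (V v \<bullet> (W' ^\<^sub>m (m - 1) *\<^sub>v V v)))
        = real m * \<sigma> * (V v \<bullet> (W' ^\<^sub>m (m - 1) *\<^sub>v V v))"
      unfolding c_def by (simp add: exp_minus)
    moreover have "real m * (- \<sigma>) * (V v \<bullet> (W' ^\<^sub>m (m - 1) *\<^sub>v V v))
        = - (real m * \<sigma> * (V v \<bullet> (W' ^\<^sub>m (m - 1) *\<^sub>v V v)))" by (simp only: mult_minus_left mult_minus_right)
    ultimately show ?thesis unfolding W'_def[symmetric] by linarith
  qed
  then have "(\<Sum>v<n. tr_mat ((W + (- \<sigma>) \<cdot>\<^sub>m rank1_mat k (V v)) ^\<^sub>m m))
      \<le> (\<Sum>v<n. tr_mat (W ^\<^sub>m m) - c * (V v \<bullet> (W ^\<^sub>m (m - 1) *\<^sub>v V v)))"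
    by (intro sum_mono) auto
  also have "\<dots> = real n * tr_mat (W ^\<^sub>m m) - c * tr_mat (W ^\<^sub>m (m - 1))"
    using sum_form_eq_tr_mat[OF pow_carrier_mat[OF psd_mat_carrier[OF W]], of "m - 1"]
    by (simp add: sum_subtractf sum_distrib_left[symmetric])
  also have "\<dots> \<le> real n * tr_mat (W ^\<^sub>m m) - c * tr_mat (W ^\<^sub>m m)"
  proof (intro diff_left_mono mult_left_mono[OF _ c])
    have "tr_mat (W ^\<^sub>m Suc (m - 1)) \<le> tr_mat (W ^\<^sub>m (m - 1))"
      unfolding tr_mat_eq_sum_form[OF pow_carrier_mat[OF psd_mat_carrier[OF W]]]
      by (intro sum_mono psd_form_pow_Suc_le[OF W unit_vec_carrier Wle])
    then show "tr_mat (W ^\<^sub>m m) \<le> tr_mat (W ^\<^sub>m (m - 1))" by (simp only: m)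
  qed
  finally show ?thesis by (simp add: W_def c_def e_def a_def tr_pow_def left_diff_distrib)
qed

text \<open>Markov's inequality for \<open>tr_pow\<close> with \<open>\<tau> = \<theta> / m\<close>:
  on the event some unit vector has form at least \<open>1 + \<tau> * c\<close>, which forces the
  trace above \<open>(1 + \<tau> * c) ^ m\<close>. Then \<open>m\<close> tends to infinity.\<close>

lemma prob_sample_form_gt_le:
  assumes \<rho>: "\<rho> \<le> n" and n: "0 < n" and \<theta>: "0 < \<theta>" and c: "0 \<le> c"
    and R: "\<And>i. i < n \<Longrightarrow> V i \<bullet> V i \<le> R"
  shows "measure_pmf.prob (draw_without_replacement n \<rho>)
      {\<omega>. \<exists>x\<in>carrier_vec k. x \<bullet> x = 1 \<and> c < (\<Sum>i\<in>set \<omega>. (V i \<bullet> x)\<^sup>2)}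
    \<le> real k * exp (real \<rho> * (\<theta> / real n * exp (\<theta> * R)) - \<theta> * c)" (is "?p \<le> _")
proof -
  define E where "E = exp (real \<rho> * (\<theta> / real n * exp (\<theta> * R)))"
  have bound: "?p \<le> E * real k / (1 + \<theta> * c / real m) ^ m" if odd: "odd m" for m
  proof -
    have m: "0 < m" using odd by (cases m) auto
    define \<tau> where "\<tau> = \<theta> / real m"
    have \<tau>: "0 < \<tau>" "real m * \<tau> = \<theta>" using \<theta> m by (simp_all add: \<tau>_def)
    define g where "g = exp (\<theta> / real n * exp (\<theta> * R))"
    have \<tau>R: "real m * (\<tau> * R) = \<theta> * R" using \<tau>(2) by (metis mult.assoc)
    have "subset_average {..<n} \<rho> (tr_pow m \<tau>) \<le> g ^ \<rho> * real k"
    proof (rule subset_average_tr_pow_le[OF _ odd \<rho>])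
      fix U :: "nat set"
      \<comment> \<open>\<open>1 + x \<le> exp x\<close> makes the growth factor of one draw an
        exponential, so that \<open>\<rho>\<close> draws multiply to \<open>E\<close>.\<close>
      have "real n + \<theta> * exp (\<theta> * R) = real n * (1 + \<theta> / real n * exp (\<theta> * R))"
        using n by (simp add: distrib_left)
      also have "\<dots> \<le> real n * g" unfolding g_def using exp_ge_add_one_self by (intro mult_left_mono) auto
      finally have "(real n + \<theta> * exp (\<theta> * R)) * tr_pow m \<tau> U \<le> real n * g * tr_pow m \<tau> U"
        using \<tau> by (intro mult_right_mono tr_pow_nonneg) auto
      then show "(\<Sum>v<n. tr_mat ((weighted_mat (sample_weight \<tau> U) + \<tau> \<cdot>\<^sub>m rank1_mat k (V v)) ^\<^sub>m m))
          \<le> real n * g * tr_pow m \<tau> U"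
        using sum_tr_update_pos_le[OF less_imp_le[OF \<tau>(1)] odd R, of U] unfolding \<tau>(2) \<tau>R by linarith
    qed (use \<tau> in \<open>auto simp: g_def\<close>)
    also have "g ^ \<rho> = E" unfolding g_def E_def by (simp only: exp_of_nat_mult)
    finally have "subset_average {..<n} \<rho> (tr_pow m \<tau>) \<le> E * real k" .
    moreover have "?p \<le> subset_average {..<n} \<rho> (tr_pow m \<tau>) / (1 + \<tau> * c) ^ m"
    proof (rule prob_draw_without_replacement_markov[OF \<rho>])
      fix U assume U: "U \<subseteq> {..<n}" and "\<exists>x\<in>carrier_vec k. x \<bullet> x = 1 \<and> c < (\<Sum>i\<in>U. (V i \<bullet> x)\<^sup>2)"
      then obtain x where x: "x \<in> carrier_vec k" "x \<bullet> x = 1" "c < (\<Sum>i\<in>U. (V i \<bullet> x)\<^sup>2)" by auto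
      have W: "psd_mat k (weighted_mat (sample_weight \<tau> U))" using \<tau> by (intro psd_sample) auto
      have "1 + \<tau> * c \<le> x \<bullet> (weighted_mat (sample_weight \<tau> U) *\<^sub>v x)"
        unfolding weighted_mat_form[OF x(1)] sum_sample_weight[OF U] using x \<tau> by simp
      then have "(1 + \<tau> * c) ^ m \<le> x \<bullet> (weighted_mat (sample_weight \<tau> U) ^\<^sub>m m *\<^sub>v x)"
        using \<tau> c by (intro psd_form_power_le[OF W x(1,2)]) (auto simp: add_pos_nonneg)
      also have "\<dots> \<le> tr_pow m \<tau> U"
        unfolding tr_pow_def by (rule psd_form_le_tr_mat[OF psd_pow_mat[OF W] x(1,2)])
      finally show "(1 + \<tau> * c) ^ m \<le> tr_pow m \<tau> U" .
    qed (use \<tau> c in \<open>auto intro!: tr_pow_nonneg simp: add_pos_nonneg\<close>)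
    moreover have "0 < (1 + \<tau> * c) ^ m" using \<tau> c by (simp add: add_pos_nonneg)
    ultimately have "?p \<le> E * real k / (1 + \<tau> * c) ^ m"
      using divide_right_mono[of "subset_average {..<n} \<rho> (tr_pow m \<tau>)" "E * real k" "(1 + \<tau> * c) ^ m"]
      by linarith
    then show ?thesis by (simp add: \<tau>_def)
  qed
  have "(\<lambda>q. E * real k / (1 + \<theta> * c / real (2 * q + 1)) ^ (2 * q + 1)) \<longlonglongrightarrow> E * real k / exp (\<theta> * c)"
    by (intro tendsto_intros tendsto_exp_limit_odd) simp
  then have "?p \<le> E * real k / exp (\<theta> * c)"
    by (rule LIMSEQ_le_const, intro exI allI impI) (rule bound, simp)
  then show ?thesis by (simp add: E_def exp_diff mult.commute)
qed

text \<open>The same argument with weights \<open>- \<theta> / m\<close>, for which a small sampled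
  sum means a large form. The hypothesis \<open>c \<le> 1\<close> keeps the Markov threshold
  positive.\<close>

lemma prob_sample_form_less_le:
  assumes \<rho>: "\<rho> \<le> n" and n: "0 < n" and \<theta>: "0 < \<theta>" and c: "c \<le> 1"
    and R: "\<And>i. i < n \<Longrightarrow> V i \<bullet> V i \<le> R"
  shows "measure_pmf.prob (draw_without_replacement n \<rho>)
      {\<omega>. \<exists>x\<in>carrier_vec k. x \<bullet> x = 1 \<and> (\<Sum>i\<in>set \<omega>. (V i \<bullet> x)\<^sup>2) < c}
    \<le> real k * exp (\<theta> * c - real \<rho> * (\<theta> / real n * exp (- (\<theta> * R))))" (is "?p \<le> _")
proof -
  \<comment> \<open>Unlike in the upper tail, this factor depends on \<open>m\<close>: the loss
    \<open>1 - 2 * \<theta> / m\<close> from repeated indices disappears only in the limit.\<close>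
  define E where "E m = exp (- (real \<rho> * (\<theta> / real n * exp (- (\<theta> * R / (1 - 2 * \<theta> / real m))))))" for m :: nat
  have bound: "?p \<le> E m * real k / (1 + (- (\<theta> * c)) / real m) ^ m"
    if odd: "odd m" and m2: "2 * \<theta> < real m" for m
  proof -
    have m: "0 < m" using odd by (cases m) auto
    define \<sigma> where "\<sigma> = \<theta> / real m"
    have \<sigma>: "0 < \<sigma>" "real m * \<sigma> = \<theta>" "\<sigma> < 1 / 2" using \<theta> m m2 by (simp_all add: \<sigma>_def field_simps)
    define e where "e = exp (- (\<theta> * R / (1 - 2 * \<theta> / real m)))"
    define g where "g = exp (- (\<theta> / real n * e))"
    have \<sigma>R: "real m * (\<sigma> * R / (1 - 2 * \<sigma>)) = \<theta> * R / (1 - 2 * \<theta> / real m)"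
      using m by (simp add: \<sigma>_def)
    have "subset_average {..<n} \<rho> (tr_pow m (- \<sigma>)) \<le> g ^ \<rho> * real k"
    proof (rule subset_average_tr_pow_le[OF _ odd \<rho>])
      fix U :: "nat set"
      have "real n - \<theta> * e = real n * (1 + - (\<theta> / real n * e))"
        using n by (simp add: right_diff_distrib)
      also have "\<dots> \<le> real n * g"
        unfolding g_def by (intro mult_left_mono exp_ge_add_one_self) auto
      finally have "(real n - \<theta> * e) * tr_pow m (- \<sigma>) U \<le> real n * g * tr_pow m (- \<sigma>) U"
        using \<sigma> by (intro mult_right_mono tr_pow_nonneg) auto
      then show "(\<Sum>v<n. tr_mat ((weighted_mat (sample_weight (- \<sigma>) U) + (- \<sigma>) \<cdot>\<^sub>m rank1_mat k (V v)) ^\<^sub>m m))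
          \<le> real n * g * tr_pow m (- \<sigma>) U"
        using sum_tr_update_neg_le[OF less_imp_le[OF \<sigma>(1)] \<sigma>(3) odd R, of U]
        unfolding \<sigma>(2) \<sigma>R e_def by linarith
    qed (use \<sigma> in \<open>auto simp: g_def\<close>)
    also have "g ^ \<rho> = E m" unfolding g_def E_def e_def by (simp only: exp_of_nat_mult[symmetric] mult_minus_right)
    finally have "subset_average {..<n} \<rho> (tr_pow m (- \<sigma>)) \<le> E m * real k" .
    moreover have pos: "0 < 1 - \<sigma> * c"
      using \<sigma> mult_left_mono[OF c less_imp_le[OF \<sigma>(1)]] by linarith
    moreover have "?p \<le> subset_average {..<n} \<rho> (tr_pow m (- \<sigma>)) / (1 - \<sigma> * c) ^ m"
    proof (rule prob_draw_without_replacement_markov[OF \<rho>])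
      fix U assume U: "U \<subseteq> {..<n}" and "\<exists>x\<in>carrier_vec k. x \<bullet> x = 1 \<and> (\<Sum>i\<in>U. (V i \<bullet> x)\<^sup>2) < c"
      then obtain x where x: "x \<in> carrier_vec k" "x \<bullet> x = 1" "(\<Sum>i\<in>U. (V i \<bullet> x)\<^sup>2) < c" by auto
      have W: "psd_mat k (weighted_mat (sample_weight (- \<sigma>) U))" using \<sigma> by (intro psd_sample) auto
      have "1 - \<sigma> * c \<le> x \<bullet> (weighted_mat (sample_weight (- \<sigma>) U) *\<^sub>v x)"
        unfolding weighted_mat_form[OF x(1)] sum_sample_weight[OF U] using x \<sigma> by simp
      then have "(1 - \<sigma> * c) ^ m \<le> x \<bullet> (weighted_mat (sample_weight (- \<sigma>) U) ^\<^sub>m m *\<^sub>v x)"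
        by (rule psd_form_power_le[OF W x(1,2) pos])
      also have "\<dots> \<le> tr_pow m (- \<sigma>) U"
        unfolding tr_pow_def by (rule psd_form_le_tr_mat[OF psd_pow_mat[OF W] x(1,2)])
      finally show "(1 - \<sigma> * c) ^ m \<le> tr_pow m (- \<sigma>) U" .
    qed (use \<sigma> pos in \<open>auto intro!: tr_pow_nonneg\<close>)
    moreover have "0 \<le> (1 - \<sigma> * c) ^ m" using pos by simp
    ultimately have "?p \<le> E m * real k / (1 - \<sigma> * c) ^ m"
      using divide_right_mono[of "subset_average {..<n} \<rho> (tr_pow m (- \<sigma>))" "E m * real k" "(1 - \<sigma> * c) ^ m"]
      by linarith
    then show ?thesis by (simp add: \<sigma>_def)
  qed
  have "(\<lambda>m. \<theta> * R / (1 - 2 * \<theta> / real m)) \<longlonglongrightarrow> \<theta> * R / (1 - 0)"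
    by (intro tendsto_intros lim_const_over_n) simp
  then have "E \<longlonglongrightarrow> exp (- (real \<rho> * (\<theta> / real n * exp (- (\<theta> * R)))))" (is "_ \<longlonglongrightarrow> ?E")
    unfolding E_def by (intro tendsto_intros) simp
  then have "(\<lambda>q. E (2 * q + 1)) \<longlonglongrightarrow> ?E"
    using LIMSEQ_subseq_LIMSEQ[OF _ strict_mono_odd] unfolding o_def by blast
  then have lim: "(\<lambda>q. E (2 * q + 1) * real k / (1 + (- (\<theta> * c)) / real (2 * q + 1)) ^ (2 * q + 1))
      \<longlonglongrightarrow> ?E * real k / exp (- (\<theta> * c))"
    by (intro tendsto_divide[OF tendsto_mult[OF _ tendsto_const] tendsto_exp_limit_odd] exp_not_eq_zero)
  have "?p \<le> ?E * real k / exp (- (\<theta> * c))"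
  proof (rule LIMSEQ_le_const[OF lim], intro exI allI impI)
    \<comment> \<open>From this index on \<open>2 * \<theta> < 2 * q + 1\<close>, which is the
      condition \<open>\<sigma> < 1 / 2\<close>.\<close>
    fix q :: nat assume "nat \<lceil>2 * \<theta>\<rceil> \<le> q"
    then have "2 * \<theta> < real (2 * q + 1)" by linarith
    then show "?p \<le> E (2 * q + 1) * real k / (1 + (- (\<theta> * c)) / real (2 * q + 1)) ^ (2 * q + 1)"
      by (intro bound) auto
  qed
  also have "\<dots> = real k * exp (\<theta> * c - real \<rho> * (\<theta> / real n * exp (- (\<theta> * R))))"
    unfolding diff_conv_add_uminus[of "\<theta> * c"] exp_add exp_minus[of "\<theta> * c"] divide_inverse inverse_inverse_eq
    by (simp only: mult_ac)
  finally show ?thesis .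
qed

end

section \<open>Sampling low-rank matrices\<close>

text \<open>The bound \<open>1 + t + t\<^sup>2\<close> is used at \<open>t = x / 2\<close> and
  squared, which gives slope 1.15. Used at \<open>x\<close> itself it would give slope 1.18, too
  large for the upper tail.\<close>

lemma exp_le_linear:
  assumes "0 \<le> (x :: real)" "x \<le> 18 / 100"
  shows "exp x \<le> 1 + 115 / 100 * x"
proof -
  define t where "t = x / 2"
  have t: "0 \<le> t" "t \<le> 9 / 100" using assms by (auto simp: t_def)
  have t2: "t * t \<le> 9 / 100 * t" using t by (intro mult_right_mono) auto
  have t3: "t * (t * t) \<le> t * (9 / 100 * t)" by (rule mult_left_mono[OF t2 t(1)])
  have t4: "t * (t * (t * t)) \<le> t * (t * (9 / 100 * t))" by (rule mult_left_mono[OF t3 t(1)])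
  have poly: "1 + 2 * t + 3 * (t * t) + 2 * (t * (t * t)) + t * (t * (t * t)) \<le> 1 + 23 / 10 * t"
    using t t2 t3 t4 by (simp add: mult_ac)
  have "exp x = (exp t)\<^sup>2" unfolding power2_eq_square exp_add[symmetric] by (simp add: t_def)
  also have "\<dots> \<le> (1 + t + t\<^sup>2)\<^sup>2" using t by (intro power_mono exp_bound) auto
  also have "\<dots> = 1 + 2 * t + 3 * (t * t) + 2 * (t * (t * t)) + t * (t * (t * t))"
    by (simp add: power2_eq_square algebra_simps)
  also note poly
  finally show ?thesis by (simp add: t_def)
qed

section \<open>Orthonormal columns and coherence\<close>

lemma first_cols_gram:
  assumes Q: "Q \<in> carrier_mat n n" and gram: "transpose_mat Q * Q = 1\<^sub>m n" and k: "k \<le> n"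
  shows "first_cols k Q \<in> carrier_mat n k" "transpose_mat (first_cols k Q) * first_cols k Q = 1\<^sub>m k"
proof -
  show c: "first_cols k Q \<in> carrier_mat n k" using Q k by (auto simp: first_cols_def)
  have col: "col (first_cols k Q) a = col Q a" if "a < k" for a
    using that Q k unfolding first_cols_def by (subst col_mat_of_cols) auto
  show "transpose_mat (first_cols k Q) * first_cols k Q = 1\<^sub>m k"
  proof (rule eq_matI)
    fix a b assume "a < dim_row (1\<^sub>m k :: real mat)" "b < dim_col (1\<^sub>m k :: real mat)"
    then have ab: "a < k" "b < k" by auto
    then have "(transpose_mat (first_cols k Q) * first_cols k Q) $$ (a, b) = (transpose_mat Q * Q) $$ (a, b)"
      using c Q k col by simp
    then show "(transpose_mat (first_cols k Q) * first_cols k Q) $$ (a, b) = 1\<^sub>m k $$ (a, b)"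
      unfolding gram using ab k by simp
  qed (use c in auto)
qed

lemma parseval_frame_rows:
  assumes B: "B \<in> carrier_mat n k" and gram: "transpose_mat B * B = 1\<^sub>m k"
  shows "parseval_frame k n (row B)"
proof
  show "row B i \<in> carrier_vec k" if "i < n" for i using B that by auto
  fix a b assume ab: "a < k" "b < k"
  have "(\<Sum>i<n. row B i $ a * row B i $ b) = (transpose_mat B * B) $$ (a, b)"
    using ab B by (auto simp: scalar_prod_def lessThan_atLeast0 intro!: sum.cong)
  then show "(\<Sum>i<n. row B i $ a * row B i $ b) = (if a = b then 1 else 0)"
    unfolding gram using ab by simp
qed

lemma row_norm_le_coherence:
  assumes B: "B \<in> carrier_mat n k" and i: "i < n"
  shows "row B i \<bullet> row B i \<le> (cumulative_coherence B)\<^sup>2 / real n"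
proof -
  have row: "transpose_mat B *\<^sub>v unit_vec n i = row B i"
    using B i by (intro eq_vecI) auto
  have r: "0 \<le> row B i \<bullet> row B i" unfolding scalar_prod_def by (intro sum_nonneg) (rule zero_le_square)
  have "sqrt (real n) * l2_norm_vec (transpose_mat B *\<^sub>v unit_vec n i) \<le> cumulative_coherence B"
    unfolding cumulative_coherence_def using B i by (intro Max_ge) auto
  then have "sqrt (real n * (row B i \<bullet> row B i)) \<le> cumulative_coherence B"
    unfolding row l2_norm_vec_def real_sqrt_mult .
  then have "real n * (row B i \<bullet> row B i) \<le> (cumulative_coherence B)\<^sup>2"
    by (rule sqrt_le_D)
  then show ?thesis using i by (simp add: field_simps)
qed

text \<open>The squared row norms add up to \<open>k\<close>, and each is at most the squared
  coherence divided by \<open>n\<close>. For \<open>1 \<le> k\<close> this makes the coherence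
  nonzero.\<close>

lemma coherence_sq_ge:
  assumes B: "B \<in> carrier_mat n k" and gram: "transpose_mat B * B = 1\<^sub>m k"
  shows "real k \<le> (cumulative_coherence B)\<^sup>2"
proof -
  interpret parseval_frame k n "row B" by (rule parseval_frame_rows[OF B gram])
  have "real k = (\<Sum>i<n. row B i \<bullet> (1\<^sub>m k *\<^sub>v row B i))"
    by (subst sum_form_eq_tr_mat) (auto simp: tr_mat_def)
  also have "\<dots> \<le> (\<Sum>i<n. (cumulative_coherence B)\<^sup>2 / real n)"
    using row_norm_le_coherence[OF B] B by (intro sum_mono) auto
  also have "\<dots> \<le> (cumulative_coherence B)\<^sup>2" by (cases "n = 0") auto
  finally show ?thesis .
qed

text \<open>The whole column space is covered, so one sample serves all rows or all columns of
  \<open>Y\<close>. The constant 0.414 is just below \<open>sqrt 2 - 1\<close>, the largest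
  \<open>b\<close> with \<open>(1 + b * \<delta>)\<^sup>2 \<le> 1 + \<delta>\<close> for all
  \<open>\<delta>\<close> in (0,1).\<close>

definition sampling_isometry :: "nat \<Rightarrow> real \<Rightarrow> real mat \<Rightarrow> real \<Rightarrow> nat set \<Rightarrow> bool" where
  "sampling_isometry n r B \<delta> U \<longleftrightarrow> (\<forall>y \<in> vec_space.col_space n B.
     (1 - \<delta> / 2) * (r / real n) * (\<Sum>i<n. (y $ i)\<^sup>2) \<le> (\<Sum>i\<in>U. (y $ i)\<^sup>2) \<and>
     (\<Sum>i\<in>U. (y $ i)\<^sup>2) \<le> (1 + 414 / 1000 * \<delta>) * (r / real n) * (\<Sum>i<n. (y $ i)\<^sup>2))"

text \<open>The inequalities are homogeneous, so a violating \<open>y = B z\<close> can be rescaled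
  to a unit vector \<open>z\<close>; orthonormality gives \<open>|y| = |z|\<close>.\<close>

lemma not_sampling_isometryE:
  assumes B: "B \<in> carrier_mat n k" and gram: "transpose_mat B * B = 1\<^sub>m k"
    and U: "U \<subseteq> {..<n}" and not: "\<not> sampling_isometry n r B \<delta> U"
  obtains x where "x \<in> carrier_vec k" "x \<bullet> x = 1"
    "(1 + 414 / 1000 * \<delta>) * (r / real n) < (\<Sum>i\<in>U. (row B i \<bullet> x)\<^sup>2) \<or>
     (\<Sum>i\<in>U. (row B i \<bullet> x)\<^sup>2) < (1 - \<delta> / 2) * (r / real n)"
proof -
  interpret fr: parseval_frame k n "row B" by (rule parseval_frame_rows[OF B gram])
  interpret vec_space "TYPE(real)" n .
  from not obtain y where "y \<in> col_space B"
    and y: "(1 + 414 / 1000 * \<delta>) * (r / real n) * (\<Sum>i<n. (y $ i)\<^sup>2) < (\<Sum>i\<in>U. (y $ i)\<^sup>2) \<or>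
     (\<Sum>i\<in>U. (y $ i)\<^sup>2) < (1 - \<delta> / 2) * (r / real n) * (\<Sum>i<n. (y $ i)\<^sup>2)"
    unfolding sampling_isometry_def by fastforce
  then obtain z where z: "z \<in> carrier_vec k" "y = B *\<^sub>v z"
    using B col_space_eq[OF B] by auto
  have yi: "y $ i = row B i \<bullet> z" if "i < n" for i using that B z by simp
  have full: "(\<Sum>i<n. (y $ i)\<^sup>2) = z \<bullet> z"
    using fr.sum_sq_eq[OF z(1)] by (simp add: yi)
  have part: "(\<Sum>i\<in>U. (y $ i)\<^sup>2) = (\<Sum>i\<in>U. (row B i \<bullet> z)\<^sup>2)"
    using U by (intro sum.cong) (auto simp: yi)
  \<comment> \<open>For \<open>z = 0\<close> the strict inequality in \<open>y\<close> would read
    \<open>0 < 0\<close>.\<close>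
  have z0: "z \<noteq> 0\<^sub>v k"
  proof
    assume z0: "z = 0\<^sub>v k"
    have "y $ i = 0" if "i < n" for i unfolding yi[OF that] z0 using that B by (intro scalar_prod_right_zero) auto
    then have "(\<Sum>i\<in>U. (y $ i)\<^sup>2) = 0" "(\<Sum>i<n. (y $ i)\<^sup>2) = 0"
      using U by (auto intro!: sum.neutral)
    then show False using y by simp
  qed
  have pos: "0 < z \<bullet> z" by (rule scalar_prod_self_pos[OF z(1) z0])
  define s where "s = 1 / sqrt (z \<bullet> z)"
  have s2: "s\<^sup>2 = 1 / (z \<bullet> z)" using pos by (simp add: s_def power_divide)
  have "(s \<cdot>\<^sub>v z) \<bullet> (s \<cdot>\<^sub>v z) = s\<^sup>2 * (z \<bullet> z)"
    using z(1) by (simp add: scalar_prod_smult_distrib[of _ k] smult_scalar_prod_distrib[of _ k] power2_eq_square)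
  then have unit: "(s \<cdot>\<^sub>v z) \<bullet> (s \<cdot>\<^sub>v z) = 1" using pos by (simp add: s2)
  have "(row B i \<bullet> (s \<cdot>\<^sub>v z))\<^sup>2 = s\<^sup>2 * (row B i \<bullet> z)\<^sup>2" if "i < n" for i
    using z(1) that by (simp add: scalar_prod_smult_distrib[of _ k] power_mult_distrib)
  then have scaled: "(\<Sum>i\<in>U. (row B i \<bullet> (s \<cdot>\<^sub>v z))\<^sup>2) = (\<Sum>i\<in>U. (row B i \<bullet> z)\<^sup>2) / (z \<bullet> z)"
    unfolding sum_divide_distrib using U by (intro sum.cong) (auto simp: s2)
  show ?thesis
  proof (rule that[OF _ unit])
    show "s \<cdot>\<^sub>v z \<in> carrier_vec k" using z(1) by simp
    show "(1 + 414 / 1000 * \<delta>) * (r / real n) < (\<Sum>i\<in>U. (row B i \<bullet> (s \<cdot>\<^sub>v z))\<^sup>2) \<or>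
     (\<Sum>i\<in>U. (row B i \<bullet> (s \<cdot>\<^sub>v z))\<^sup>2) < (1 - \<delta> / 2) * (r / real n)"
      using y pos unfolding scaled full part
      by (auto simp: pos_less_divide_eq pos_divide_less_eq simp del: times_divide_eq_right times_divide_eq_left)
  qed
qed

text \<open>The upper and the lower tail each get \<open>\<epsilon> / 4\<close>. The event is
  restricted to indices below \<open>n\<close>, where a failed isometry yields a unit vector in one
  of the tails.\<close>

lemma prob_not_sampling_isometry_le:
  assumes B: "B \<in> carrier_mat n k" and gram: "transpose_mat B * B = 1\<^sub>m k"
    and k: "1 \<le> k" and n: "0 < n" and \<rho>: "\<rho> \<le> n"
    and \<delta>: "0 < \<delta>" "\<delta> < 1" and \<epsilon>: "0 < \<epsilon>" "\<epsilon> < 1"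
    and bound: "real \<rho> \<ge> 27 / \<delta>\<^sup>2 * (cumulative_coherence B)\<^sup>2 * ln (4 * real k / \<epsilon>)"
  shows "measure_pmf.prob (draw_without_replacement n \<rho>) {\<omega>. set \<omega> \<subseteq> {..<n} \<and> \<not> sampling_isometry n (real \<rho>) B \<delta> (set \<omega>)}
    \<le> \<epsilon> / 2"
proof -
  interpret parseval_frame k n "row B" by (rule parseval_frame_rows[OF B gram])
  let ?M = "draw_without_replacement n \<rho>"
  define N where "N = (cumulative_coherence B)\<^sup>2"
  define R where "R = N / real n"
  define l where "l = ln (4 * real k / \<epsilon>)"
  define \<kappa> where "\<kappa> = real \<rho> / N"
  have N: "0 < N" using coherence_sq_ge[OF B gram] k unfolding N_def by linarith
  have R: "row B i \<bullet> row B i \<le> R" if "i < n" for i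
    using row_norm_le_coherence[OF B that] by (simp add: R_def N_def)
  have \<kappa>0: "0 \<le> \<kappa>" using N by (simp add: \<kappa>_def)
  have \<kappa>: "l \<le> \<delta>\<^sup>2 * \<kappa> / 27"
    using bound N \<delta> unfolding \<kappa>_def l_def[symmetric] N_def[symmetric] by (simp add: field_simps)
  \<comment> \<open>The sample size condition reads
    \<open>l \<le> \<delta>\<^sup>2 * \<kappa> / 27\<close> with
    \<open>l = ln (4 * real k / \<epsilon>)\<close>, so such an exponent also pays for the factor
    \<open>k\<close>.\<close>
  have tail: "real k * exp e \<le> \<epsilon> / 4" if "e \<le> - (\<delta>\<^sup>2 * \<kappa> / 27)" for e
  proof -
    have "exp e \<le> exp (- l)" using that \<kappa> by simp
    also have "\<dots> = \<epsilon> / (4 * real k)" unfolding l_def using k \<epsilon> by (simp add: exp_minus)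
    finally have "real k * exp e \<le> real k * (\<epsilon> / (4 * real k))" by (rule mult_left_mono) simp
    then show ?thesis using k by simp
  qed
  define cu where "cu = (1 + 414 / 1000 * \<delta>) * (real \<rho> / real n)"
  define cl where "cl = (1 - \<delta> / 2) * (real \<rho> / real n)"
  let ?up = "{\<omega>. \<exists>x\<in>carrier_vec k. x \<bullet> x = 1 \<and> cu < (\<Sum>i\<in>set \<omega>. (row B i \<bullet> x)\<^sup>2)}"
  let ?lo = "{\<omega>. \<exists>x\<in>carrier_vec k. x \<bullet> x = 1 \<and> (\<Sum>i\<in>set \<omega>. (row B i \<bullet> x)\<^sup>2) < cl}"
  have up: "measure_pmf.prob ?M ?up \<le> \<epsilon> / 4"
  proof -
    \<comment> \<open>In terms of \<open>x = \<theta> R\<close> the exponent is \<open>\<kappa> (x (exp x - 1) - 0.414 \<delta> x)\<close>, and \<open>x = 0.18 \<delta>\<close>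
      nearly minimises it: the value is below \<open>- \<delta>\<^sup>2 \<kappa> / 27\<close> only by a small margin.\<close>
    define \<theta> where "\<theta> = 18 / 100 * \<delta> / R"
    have R0: "0 < R" using N n by (simp add: R_def)
    have \<theta>: "0 < \<theta>" "\<theta> * R = 18 / 100 * \<delta>" "real \<rho> * (\<theta> / real n) = 18 / 100 * \<delta> * \<kappa>"
      using \<delta> N n R0 by (simp_all add: \<theta>_def R_def \<kappa>_def field_simps)
    have \<theta>c: "\<theta> * cu = (1 + 414 / 1000 * \<delta>) * (18 / 100 * \<delta> * \<kappa>)"
      unfolding cu_def \<theta>(3)[symmetric] by simp
    have "measure_pmf.prob ?M ?up \<le> real k * exp (real \<rho> * (\<theta> / real n * exp (\<theta> * R)) - \<theta> * cu)"
      using \<delta> by (intro prob_sample_form_gt_le[OF \<rho> n \<theta>(1) _ R]) (auto simp: cu_def)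
    also have "\<dots> \<le> \<epsilon> / 4"
    proof (rule tail)
      have "exp (18 / 100 * \<delta>) \<le> 1 + 115 / 100 * (18 / 100 * \<delta>)" using \<delta> by (intro exp_le_linear) auto
      then have "18 / 100 * \<delta> * \<kappa> * exp (18 / 100 * \<delta>) \<le> 18 / 100 * \<delta> * \<kappa> * (1 + 115 / 100 * (18 / 100 * \<delta>))"
        using \<delta> \<kappa>0 by (intro mult_left_mono) auto
      moreover have "real \<rho> * (\<theta> / real n * exp (\<theta> * R)) = 18 / 100 * \<delta> * \<kappa> * exp (18 / 100 * \<delta>)"
        unfolding \<theta>(2) mult.assoc[symmetric, of "real \<rho>"] \<theta>(3) ..
      \<comment> \<open>\<open>0.18 (0.414 - 1.15 * 0.18) = 0.03726\<close>, while
        \<open>1 / 27\<close> is about 0.03704.\<close>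
      moreover have "18 / 100 * \<delta> * \<kappa> * (1 + 115 / 100 * (18 / 100 * \<delta>)) - \<theta> * cu = - (3726 / 100000) * (\<delta>\<^sup>2 * \<kappa>)"
        unfolding \<theta>c by (simp add: power2_eq_square algebra_simps)
      moreover have "0 \<le> \<delta>\<^sup>2 * \<kappa>" using \<kappa>0 by simp
      ultimately show "real \<rho> * (\<theta> / real n * exp (\<theta> * R)) - \<theta> * cu \<le> - (\<delta>\<^sup>2 * \<kappa> / 27)" by linarith
    qed
    finally show ?thesis .
  qed
  have lo: "measure_pmf.prob ?M ?lo \<le> \<epsilon> / 4"
  proof -
    \<comment> \<open>With \<open>x = \<theta> * R\<close>, the bound
      \<open>1 - x \<le> exp (- x)\<close> leaves the exponent
      \<open>\<kappa> (x^2 - \<delta> x / 2)\<close>, minimal at \<open>x = \<delta> / 4\<close>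
      with value \<open>- \<delta>^2 \<kappa> / 16\<close>.\<close>
    define \<theta> where "\<theta> = \<delta> / 4 / R"
    have R0: "0 < R" using N n by (simp add: R_def)
    have \<theta>: "0 < \<theta>" "\<theta> * R = \<delta> / 4" "real \<rho> * (\<theta> / real n) = \<delta> / 4 * \<kappa>"
      using \<delta> N n R0 by (simp_all add: \<theta>_def R_def \<kappa>_def field_simps)
    have \<theta>c: "\<theta> * cl = (1 - \<delta> / 2) * (\<delta> / 4 * \<kappa>)"
      unfolding cl_def \<theta>(3)[symmetric] by simp
    have "cl \<le> 1 * 1" unfolding cl_def using \<delta> \<rho> n by (intro mult_mono) auto
    then have "measure_pmf.prob ?M ?lo \<le> real k * exp (\<theta> * cl - real \<rho> * (\<theta> / real n * exp (- (\<theta> * R))))"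
      by (intro prob_sample_form_less_le[OF \<rho> n \<theta>(1) _ R]) auto
    also have "\<dots> \<le> \<epsilon> / 4"
    proof (rule tail)
      have "1 + - (\<delta> / 4) \<le> exp (- (\<delta> / 4))" by (rule exp_ge_add_one_self)
      then have "\<delta> / 4 * \<kappa> * (1 + - (\<delta> / 4)) \<le> \<delta> / 4 * \<kappa> * exp (- (\<delta> / 4))"
        using \<delta> \<kappa>0 by (intro mult_left_mono) auto
      moreover have "real \<rho> * (\<theta> / real n * exp (- (\<theta> * R))) = \<delta> / 4 * \<kappa> * exp (- (\<delta> / 4))"
        unfolding \<theta>(2) mult.assoc[symmetric, of "real \<rho>"] \<theta>(3) ..
      moreover have "\<theta> * cl - \<delta> / 4 * \<kappa> * (1 + - (\<delta> / 4)) = - (1 / 16) * (\<delta>\<^sup>2 * \<kappa>)"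
        unfolding \<theta>c by (simp add: power2_eq_square field_simps)
      moreover have "0 \<le> \<delta>\<^sup>2 * \<kappa>" using \<kappa>0 by simp
      ultimately show "\<theta> * cl - real \<rho> * (\<theta> / real n * exp (- (\<theta> * R))) \<le> - (\<delta>\<^sup>2 * \<kappa> / 27)" by linarith
    qed
    finally show ?thesis .
  qed
  have "{\<omega>. set \<omega> \<subseteq> {..<n} \<and> \<not> sampling_isometry n (real \<rho>) B \<delta> (set \<omega>)} \<subseteq> ?up \<union> ?lo"
    unfolding cu_def cl_def by (auto elim!: not_sampling_isometryE[OF B gram])
  then have "measure_pmf.prob ?M {\<omega>. set \<omega> \<subseteq> {..<n} \<and> \<not> sampling_isometry n (real \<rho>) B \<delta> (set \<omega>)}
      \<le> measure_pmf.prob ?M (?up \<union> ?lo)"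
    by (intro measure_pmf.finite_measure_mono) auto
  also have "\<dots> \<le> measure_pmf.prob ?M ?up + measure_pmf.prob ?M ?lo"
    by (rule measure_Un_le) auto
  finally show ?thesis using up lo by linarith
qed

section \<open>From the two isometries to the Frobenius norm\<close>

lemma set_pmf_draw_without_replacement:
  assumes "m \<le> n"
  shows "set_pmf (draw_without_replacement n m) = {xs. length xs = m \<and> distinct xs \<and> set xs \<subseteq> {..<n}}"
proof -
  have "finite {xs. length xs = m \<and> distinct xs \<and> set xs \<subseteq> {..<n}}"
    by (rule finite_subset[OF _ finite_lists_length_eq[of "{..<n}" m]]) auto
  moreover have "[0..<m] \<in> {xs. length xs = m \<and> distinct xs \<and> set xs \<subseteq> {..<n}}" using assms by auto
  ultimately show ?thesis unfolding draw_without_replacement_def by (intro set_pmf_of_set) blast+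
qed

lemma frobenius_norm_sq:
  "(frobenius_norm A)\<^sup>2 = (\<Sum>i<dim_row A. \<Sum>j<dim_col A. (A $$ (i, j))\<^sup>2)"
  unfolding frobenius_norm_def by (intro real_sqrt_pow2 sum_nonneg) auto

lemma sampled_entry:
  assumes Y: "Y \<in> carrier_mat p n" and r: "set \<omega>r \<subseteq> {..<p}" and c: "set \<omega>c \<subseteq> {..<n}"
    and i: "i < length \<omega>r" and j: "j < length \<omega>c"
  shows "(row_sampling_mat p \<omega>r * Y * col_sampling_mat n \<omega>c) $$ (i, j) = Y $$ (\<omega>r ! i, \<omega>c ! j)"
proof -
  have ri: "\<omega>r ! i < p" and cj: "\<omega>c ! j < n" using r c i j nth_mem by blast+
  have row: "(row_sampling_mat p \<omega>r * Y) $$ (i, l) = Y $$ (\<omega>r ! i, l)" if l: "l < n" for l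
  proof -
    have "(row_sampling_mat p \<omega>r * Y) $$ (i, l) = (\<Sum>q<p. row_sampling_mat p \<omega>r $$ (i, q) * Y $$ (q, l))"
      using Y i l by (auto simp: row_sampling_mat_def scalar_prod_def lessThan_atLeast0 intro!: sum.cong)
    also have "\<dots> = (\<Sum>q<p. (if q = \<omega>r ! i then Y $$ (q, l) else 0))"
      using i by (intro sum.cong) (auto simp: row_sampling_mat_def)
    finally show ?thesis using ri by simp
  qed
  have "(row_sampling_mat p \<omega>r * Y * col_sampling_mat n \<omega>c) $$ (i, j)
      = (\<Sum>l<n. (row_sampling_mat p \<omega>r * Y) $$ (i, l) * col_sampling_mat n \<omega>c $$ (l, j))"
    using Y i j by (auto simp: row_sampling_mat_def col_sampling_mat_def scalar_prod_def lessThan_atLeast0 intro!: sum.cong)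
  also have "\<dots> = (\<Sum>l<n. (if l = \<omega>c ! j then Y $$ (\<omega>r ! i, l) else 0))"
    using j by (intro sum.cong) (auto simp: row col_sampling_mat_def)
  finally show ?thesis using cj by simp
qed

lemma sampled_frobenius_norm_sq:
  assumes Y: "Y \<in> carrier_mat p n" and r: "set \<omega>r \<subseteq> {..<p}" "distinct \<omega>r"
    and c: "set \<omega>c \<subseteq> {..<n}" "distinct \<omega>c"
  shows "(frobenius_norm (row_sampling_mat p \<omega>r * Y * col_sampling_mat n \<omega>c))\<^sup>2
    = (\<Sum>i\<in>set \<omega>r. \<Sum>j\<in>set \<omega>c. (Y $$ (i, j))\<^sup>2)"
proof -
  have reindex: "(\<Sum>i<length xs. F (xs ! i)) = (\<Sum>x\<in>set xs. F x)" if "distinct xs" for xs :: "nat list" and F :: "nat \<Rightarrow> real"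
    using sum.reindex_bij_betw[OF bij_betw_nth[OF that refl refl], of F] .
  have "(frobenius_norm (row_sampling_mat p \<omega>r * Y * col_sampling_mat n \<omega>c))\<^sup>2
      = (\<Sum>i<length \<omega>r. \<Sum>j<length \<omega>c. (Y $$ (\<omega>r ! i, \<omega>c ! j))\<^sup>2)"
    unfolding frobenius_norm_sq using sampled_entry[OF Y r(1) c(1)]
    by (intro sum.cong) (auto simp: row_sampling_mat_def col_sampling_mat_def)
  also have "\<dots> = (\<Sum>i\<in>set \<omega>r. \<Sum>j\<in>set \<omega>c. (Y $$ (i, j))\<^sup>2)"
    by (simp add: reindex[OF c(2), of "\<lambda>j. (Y $$ (_, j))\<^sup>2"]
        reindex[OF r(2), of "\<lambda>i. \<Sum>j\<in>set \<omega>c. (Y $$ (i, j))\<^sup>2"])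
  finally show ?thesis .
qed

text \<open>Two stages through \<open>H\<close>, the energy of the sampled rows in all columns: the
  rows of \<open>Y\<close> lie in the span of \<open>Qk\<close>, which compares \<open>S\<close>
  with \<open>H\<close>, and its columns lie in the span of \<open>Pk\<close>, which compares
  \<open>H\<close> with \<open>F\<close>.\<close>

lemma low_rank_sampling_bounds:
  assumes Pk: "Pk \<in> carrier_mat p kr" and Qk: "Qk \<in> carrier_mat n kc"
    and Y: "Y \<in> low_rank_on_graphs Pk Qk"
    and r: "set \<omega>r \<subseteq> {..<p}" "distinct \<omega>r" and c: "set \<omega>c \<subseteq> {..<n}" "distinct \<omega>c"
    and isor: "sampling_isometry p r Pk \<delta> (set \<omega>r)" and isoc: "sampling_isometry n s Qk \<delta> (set \<omega>c)"
    and pos: "0 < n" "0 < p" "0 < r" "0 < s" and \<delta>: "0 < \<delta>" "\<delta> < 1"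
  shows "(1 - \<delta>) * (frobenius_norm Y)\<^sup>2
      \<le> real (n * p) / (r * s) * (frobenius_norm (row_sampling_mat p \<omega>r * Y * col_sampling_mat n \<omega>c))\<^sup>2"
    and "real (n * p) / (r * s) * (frobenius_norm (row_sampling_mat p \<omega>r * Y * col_sampling_mat n \<omega>c))\<^sup>2
      \<le> (1 + \<delta>) * (frobenius_norm Y)\<^sup>2"
proof -
  have Yc: "Y \<in> carrier_mat p n" using Y Pk Qk by (auto simp: low_rank_on_graphs_def)
  define a b where "a = 1 - \<delta> / 2" and "b = 1 + 414 / 1000 * \<delta>"
  define H where "H = (\<Sum>i\<in>set \<omega>r. \<Sum>j<n. (Y $$ (i, j))\<^sup>2)"
  define S where "S = (\<Sum>i\<in>set \<omega>r. \<Sum>j\<in>set \<omega>c. (Y $$ (i, j))\<^sup>2)"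
  define F where "F = (frobenius_norm Y)\<^sup>2"
  have F: "F = (\<Sum>j<n. \<Sum>i<p. (Y $$ (i, j))\<^sup>2)"
    unfolding F_def frobenius_norm_sq using Yc by (subst sum.swap) auto
  have H: "H = (\<Sum>j<n. \<Sum>i\<in>set \<omega>r. (Y $$ (i, j))\<^sup>2)" unfolding H_def by (rule sum.swap)
  have F0: "0 \<le> F" by (simp add: F_def)
  have a: "0 < a" and b: "0 < b" using \<delta> by (auto simp: a_def b_def)
  have rows: "a * (s / real n) * (\<Sum>j<n. (Y $$ (i, j))\<^sup>2) \<le> (\<Sum>j\<in>set \<omega>c. (Y $$ (i, j))\<^sup>2) \<and>
      (\<Sum>j\<in>set \<omega>c. (Y $$ (i, j))\<^sup>2) \<le> b * (s / real n) * (\<Sum>j<n. (Y $$ (i, j))\<^sup>2)" if i: "i < p" for i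
  proof -
    have "row Y i \<in> vec_space.col_space n Qk" using Y Pk Qk i by (auto simp: low_rank_on_graphs_def)
    moreover have "(\<Sum>j\<in>set \<omega>c. (row Y i $ j)\<^sup>2) = (\<Sum>j\<in>set \<omega>c. (Y $$ (i, j))\<^sup>2)"
      using c Yc i by (intro sum.cong) auto
    moreover have "(\<Sum>j<n. (row Y i $ j)\<^sup>2) = (\<Sum>j<n. (Y $$ (i, j))\<^sup>2)"
      using Yc i by (intro sum.cong) auto
    ultimately show ?thesis using isoc unfolding sampling_isometry_def a_def b_def by fastforce
  qed
  have cols: "a * (r / real p) * (\<Sum>i<p. (Y $$ (i, j))\<^sup>2) \<le> (\<Sum>i\<in>set \<omega>r. (Y $$ (i, j))\<^sup>2) \<and>
      (\<Sum>i\<in>set \<omega>r. (Y $$ (i, j))\<^sup>2) \<le> b * (r / real p) * (\<Sum>i<p. (Y $$ (i, j))\<^sup>2)" if j: "j < n" for j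
  proof -
    have "col Y j \<in> vec_space.col_space p Pk" using Y Pk Qk j by (auto simp: low_rank_on_graphs_def)
    moreover have "(\<Sum>i\<in>set \<omega>r. (col Y j $ i)\<^sup>2) = (\<Sum>i\<in>set \<omega>r. (Y $$ (i, j))\<^sup>2)"
      using r Yc j by (intro sum.cong) auto
    moreover have "(\<Sum>i<p. (col Y j $ i)\<^sup>2) = (\<Sum>i<p. (Y $$ (i, j))\<^sup>2)"
      using Yc j by (intro sum.cong) auto
    ultimately show ?thesis using isor unfolding sampling_isometry_def a_def b_def by fastforce
  qed
  have S1: "a * (s / real n) * H \<le> S" "S \<le> b * (s / real n) * H"
    unfolding H_def S_def sum_distrib_left[of _ _ "set \<omega>r"] using rows r by (auto intro!: sum_mono)
  have S2: "a * (r / real p) * F \<le> H" "H \<le> b * (r / real p) * F"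
    unfolding H F sum_distrib_left[of _ _ "{..<n}"] using cols by (auto intro!: sum_mono)
  define t where "t = real (n * p) / (r * s)"
  have t: "0 < t" using pos by (simp add: t_def)
  \<comment> \<open>The prefactor \<open>t\<close> cancels the two sampling ratios.\<close>
  have cancel: "t * (x * (s / real n) * (x * (r / real p) * F)) = x\<^sup>2 * F" for x
    using pos by (simp add: t_def power2_eq_square field_simps)
  have ab: "0 \<le> a * (s / real n)" "0 \<le> b * (s / real n)" using a b pos by simp_all
  have "a * (s / real n) * (a * (r / real p) * F) \<le> S"
    by (rule order_trans[OF mult_left_mono[OF S2(1) ab(1)] S1(1)])
  then have lower: "a\<^sup>2 * F \<le> t * S" unfolding cancel[symmetric] using t by (intro mult_left_mono) auto
  have "S \<le> b * (s / real n) * (b * (r / real p) * F)"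
    by (rule order_trans[OF S1(2) mult_left_mono[OF S2(2) ab(2)]])
  then have upper: "t * S \<le> b\<^sup>2 * F" unfolding cancel[symmetric] using t by (intro mult_left_mono) auto
  have "1 - \<delta> \<le> a\<^sup>2" by (simp add: a_def power2_diff power_divide)
  then have "(1 - \<delta>) * F \<le> t * S" using lower by (rule order_trans[OF mult_right_mono[OF _ F0]])
  moreover have "b\<^sup>2 \<le> 1 + \<delta>"
  proof -
    \<comment> \<open>The linear and quadratic coefficients 0.828 and 0.171396 add up to less than
      1.\<close>
    have "\<delta> * \<delta> \<le> 1 * \<delta>" using \<delta> by (intro mult_right_mono) auto
    moreover have "b\<^sup>2 = 1 + 828 / 1000 * \<delta> + 171396 / 1000000 * (\<delta> * \<delta>)"
      by (simp add: b_def power2_eq_square field_simps)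
    ultimately show ?thesis using \<delta> by linarith
  qed
  then have "t * S \<le> (1 + \<delta>) * F" using order_trans[OF upper mult_right_mono[OF _ F0]] by blast
  moreover have "(frobenius_norm (row_sampling_mat p \<omega>r * Y * col_sampling_mat n \<omega>c))\<^sup>2 = S"
    unfolding S_def by (rule sampled_frobenius_norm_sq[OF Yc r c])
  ultimately show "(1 - \<delta>) * (frobenius_norm Y)\<^sup>2
      \<le> real (n * p) / (r * s) * (frobenius_norm (row_sampling_mat p \<omega>r * Y * col_sampling_mat n \<omega>c))\<^sup>2"
    "real (n * p) / (r * s) * (frobenius_norm (row_sampling_mat p \<omega>r * Y * col_sampling_mat n \<omega>c))\<^sup>2
      \<le> (1 + \<delta>) * (frobenius_norm Y)\<^sup>2"
    by (simp_all add: t_def F_def)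
qed

text \<open>The logarithm and the coherence are both positive. This rules out division by zero in
  the scaling factor of the theorem.\<close>

lemma sample_size_pos:
  assumes B: "B \<in> carrier_mat n k" and gram: "transpose_mat B * B = 1\<^sub>m k" and k: "1 \<le> k"
    and \<delta>: "0 < \<delta>" and \<epsilon>: "0 < \<epsilon>" "\<epsilon> < 1"
    and bound: "real \<rho> \<ge> 27 / \<delta>\<^sup>2 * (cumulative_coherence B)\<^sup>2 * ln (4 * real k / \<epsilon>)"
  shows "0 < \<rho>"
proof -
  have "0 < (cumulative_coherence B)\<^sup>2" using coherence_sq_ge[OF B gram] k by linarith
  moreover have "0 < ln (4 * real k / \<epsilon>)" using k \<epsilon> by (intro ln_gt_zero) (simp add: field_simps)
  ultimately have "0 < 27 / \<delta>\<^sup>2 * (cumulative_coherence B)\<^sup>2 * ln (4 * real k / \<epsilon>)" using \<delta> by simp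
  then show ?thesis using bound by linarith
qed

text \<open>\<open>draws\<close> is any joint law whose marginals are the two uniform draws;
  independent draws are the product case. The hypotheses \<open>\<rho>\<^sub>c \<le> n\<close> and
  \<open>\<rho>\<^sub>r \<le> p\<close> make drawing without replacement possible.\<close>

theorem theorem1:
  fixes n p k\<^sub>c k\<^sub>r \<rho>\<^sub>c \<rho>\<^sub>r :: nat
    and W\<^sub>c W\<^sub>r L\<^sub>c L\<^sub>r Q P \<Lambda>\<^sub>c \<Lambda>\<^sub>r :: "real mat"
    and \<delta> \<epsilon> :: real
    and draws :: "(nat list \<times> nat list) pmf"
  assumes graph_c: "weighted_graph n W\<^sub>c" and graph_r: "weighted_graph p W\<^sub>r"
    and lap_c: "is_graph_laplacian n W\<^sub>c L\<^sub>c" and lap_r: "is_graph_laplacian p W\<^sub>r L\<^sub>r"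
    and eig_c: "sorted_eigendecomposition n L\<^sub>c Q \<Lambda>\<^sub>c"
    and eig_r: "sorted_eigendecomposition p L\<^sub>r P \<Lambda>\<^sub>r"
    and k_c: "1 \<le> k\<^sub>c" "k\<^sub>c \<le> n" and k_r: "1 \<le> k\<^sub>r" "k\<^sub>r \<le> p"
    and sample_c: "\<rho>\<^sub>c \<le> n" and sample_r: "\<rho>\<^sub>r \<le> p"
    and draw_r: "map_pmf fst draws = draw_without_replacement p \<rho>\<^sub>r"
    and draw_c: "map_pmf snd draws = draw_without_replacement n \<rho>\<^sub>c"
    and \<delta>: "0 < \<delta>" "\<delta> < 1" and \<epsilon>: "0 < \<epsilon>" "\<epsilon> < 1"
    and bound_c: "real \<rho>\<^sub>c \<ge> 27 / \<delta>\<^sup>2 * (cumulative_coherence (first_cols k\<^sub>c Q))\<^sup>2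
                     * ln (4 * real k\<^sub>c / \<epsilon>)"
    and bound_r: "real \<rho>\<^sub>r \<ge> 27 / \<delta>\<^sup>2 * (cumulative_coherence (first_cols k\<^sub>r P))\<^sup>2
                     * ln (4 * real k\<^sub>r / \<epsilon>)"
  shows "measure_pmf.prob draws
     {(\<omega>\<^sub>r, \<omega>\<^sub>c). \<forall>Y \<in> low_rank_on_graphs (first_cols k\<^sub>r P) (first_cols k\<^sub>c Q).
        (1 - \<delta>) * (frobenius_norm Y)\<^sup>2
          \<le> real (n * p) / real (\<rho>\<^sub>r * \<rho>\<^sub>c)
             * (frobenius_norm (row_sampling_mat p \<omega>\<^sub>r * Y * col_sampling_mat n \<omega>\<^sub>c))\<^sup>2 \<and>
        real (n * p) / real (\<rho>\<^sub>r * \<rho>\<^sub>c)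
             * (frobenius_norm (row_sampling_mat p \<omega>\<^sub>r * Y * col_sampling_mat n \<omega>\<^sub>c))\<^sup>2
          \<le> (1 + \<delta>) * (frobenius_norm Y)\<^sup>2}
     \<ge> 1 - \<epsilon>"
proof -
  define Pk where "Pk = first_cols k\<^sub>r P"
  define Qk where "Qk = first_cols k\<^sub>c Q"
  have Q: "Q \<in> carrier_mat n n" "transpose_mat Q * Q = 1\<^sub>m n"
    and P: "P \<in> carrier_mat p p" "transpose_mat P * P = 1\<^sub>m p"
    using eig_c eig_r by (auto simp: sorted_eigendecomposition_def)
  note Qk = first_cols_gram[OF Q k_c(2), folded Qk_def]
  note Pk = first_cols_gram[OF P k_r(2), folded Pk_def]
  have pos: "0 < n" "0 < p" using k_c k_r by auto
  have \<rho>pos: "0 < real \<rho>\<^sub>r" "0 < real \<rho>\<^sub>c"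
    using sample_size_pos[OF Pk k_r(1) \<delta>(1) \<epsilon> bound_r[folded Pk_def]]
      sample_size_pos[OF Qk k_c(1) \<delta>(1) \<epsilon> bound_c[folded Qk_def]] by auto
  define Br where "Br = {\<omega>. set \<omega> \<subseteq> {..<p} \<and> \<not> sampling_isometry p (real \<rho>\<^sub>r) Pk \<delta> (set \<omega>)}"
  define Bc where "Bc = {\<omega>. set \<omega> \<subseteq> {..<n} \<and> \<not> sampling_isometry n (real \<rho>\<^sub>c) Qk \<delta> (set \<omega>)}"
  have Br: "measure_pmf.prob draws (fst -` Br) \<le> \<epsilon> / 2"
    using prob_not_sampling_isometry_le[OF Pk k_r(1) pos(2) sample_r \<delta> \<epsilon> bound_r[folded Pk_def]]
    unfolding draw_r[symmetric] Br_def[symmetric] by simp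
  have Bc: "measure_pmf.prob draws (snd -` Bc) \<le> \<epsilon> / 2"
    using prob_not_sampling_isometry_le[OF Qk k_c(1) pos(1) sample_c \<delta> \<epsilon> bound_c[folded Qk_def]]
    unfolding draw_c[symmetric] Bc_def[symmetric] by simp
  have "measure_pmf.prob draws (fst -` Br \<union> snd -` Bc)
      \<le> measure_pmf.prob draws (fst -` Br) + measure_pmf.prob draws (snd -` Bc)"
    by (rule measure_Un_le) auto
  then have bad: "measure_pmf.prob draws (fst -` Br \<union> snd -` Bc) \<le> \<epsilon>" using Br Bc by linarith
  define E where "E = {(\<omega>\<^sub>r, \<omega>\<^sub>c). \<forall>Y \<in> low_rank_on_graphs (first_cols k\<^sub>r P) (first_cols k\<^sub>c Q).
        (1 - \<delta>) * (frobenius_norm Y)\<^sup>2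
          \<le> real (n * p) / real (\<rho>\<^sub>r * \<rho>\<^sub>c)
             * (frobenius_norm (row_sampling_mat p \<omega>\<^sub>r * Y * col_sampling_mat n \<omega>\<^sub>c))\<^sup>2 \<and>
        real (n * p) / real (\<rho>\<^sub>r * \<rho>\<^sub>c)
             * (frobenius_norm (row_sampling_mat p \<omega>\<^sub>r * Y * col_sampling_mat n \<omega>\<^sub>c))\<^sup>2
          \<le> (1 + \<delta>) * (frobenius_norm Y)\<^sup>2}"
  \<comment> \<open>The support supplies distinct indices in range; given these, lying outside the
    bad sets means that both isometries hold.\<close>
  have "- (fst -` Br \<union> snd -` Bc) \<inter> set_pmf draws \<subseteq> E"
  proof
    fix z assume z: "z \<in> - (fst -` Br \<union> snd -` Bc) \<inter> set_pmf draws"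
    obtain \<omega>r \<omega>c where zz: "z = (\<omega>r, \<omega>c)" by (cases z)
    have "\<omega>r \<in> set_pmf (map_pmf fst draws)" "\<omega>c \<in> set_pmf (map_pmf snd draws)"
      using z unfolding zz by force+
    then have \<omega>: "distinct \<omega>r" "set \<omega>r \<subseteq> {..<p}" "distinct \<omega>c" "set \<omega>c \<subseteq> {..<n}"
      unfolding draw_r draw_c set_pmf_draw_without_replacement[OF sample_r]
        set_pmf_draw_without_replacement[OF sample_c] by auto
    then have iso: "sampling_isometry p (real \<rho>\<^sub>r) Pk \<delta> (set \<omega>r)" "sampling_isometry n (real \<rho>\<^sub>c) Qk \<delta> (set \<omega>c)"
      using z by (auto simp: zz Br_def Bc_def)
    show "z \<in> E"
      unfolding E_def zz Pk_def[symmetric] Qk_def[symmetric]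
      using low_rank_sampling_bounds[OF Pk(1) Qk(1) _ \<omega>(2,1,4,3) iso pos \<rho>pos \<delta>] by simp
  qed
  then have "measure_pmf.prob draws (- (fst -` Br \<union> snd -` Bc) \<inter> set_pmf draws) \<le> measure_pmf.prob draws E"
    by (intro measure_pmf.finite_measure_mono) auto
  moreover have "measure_pmf.prob draws (- (fst -` Br \<union> snd -` Bc) \<inter> set_pmf draws)
      = measure_pmf.prob draws (- (fst -` Br \<union> snd -` Bc))"
    by (rule measure_Int_set_pmf)
  moreover have "measure_pmf.prob draws (- (fst -` Br \<union> snd -` Bc))
      = 1 - measure_pmf.prob draws (fst -` Br \<union> snd -` Bc)"
    using measure_pmf.prob_compl[of "fst -` Br \<union> snd -` Bc" draws] by (simp add: Compl_eq_Diff_UNIV)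
  ultimately show ?thesis using bad unfolding E_def[symmetric] by linarith
qed

end
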